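(* The group $E_{6(-14),\mathbb H}=\{\alpha\in \mathrm{Iso}_C(\mathfrak J(3,\mathbb H^C)) \mid \det(\alpha X)=\det X,\ \langle\alpha X,\alpha Y\rangle_\sigma=\langle X,Y\rangle_\sigma \text{ for all }X,Y\}$ is isomorphic to the group $SU(2,4)/\mathbb Z_2$, where $\mathbb Z_2=\{E,-E\}$.
   Context: $C=\mathbb R\oplus\mathbb R i$ is the field used for complexification; $\mathbb H$ is the quaternion algebra and $\mathbb H^C=\mathbb H\otimes_{\mathbb R}C$ with quaternionic conjugation extended $C$-linearly; $X^*={}^t\overline X$. $\mathfrak J(3,\mathbb H^C)=\{X\in M(3,\mathbb H^C)\mid X^*=X\}$, a $C$-vector space whose elements are $X=\begin{pmatrix}\xi_1&x_3&\overline x_2\\ \overline x_3&\xi_2&x_1\\ x_2&\overline x_1&\xi_3\end{pmatrix}$, $\xi_i\in C$, $x_i\in\mathbb H^C$; $\det X:=\xi_1\xi_2\xi_3+x_1x_2x_3+\overline{x_1x_2x_3}-\sum_i\xi_ix_i\overline x_i\in C$; $(X,Y)=\mathrm{tr}\big(\tfrac12(XY+YX)\big)\in C$. $\tau$ is the complex conjugation of $\mathfrak J(3,\mathbb H^C)$ with respect to $C$ ($i\mapsto -i$, fixing $\mathbb H$); $\sigma X=I_1XI_1$, $I_1=\mathrm{diag}(-1,1,1)$; $\langle X,Y\rangle_\sigma=(\tau\sigma X,Y)$. $\mathrm{Iso}_C(V)$ is the group of $C$-linear automorphisms of $V$. $SU(2,4)=\{A\in M(6,\mathbb C)\mid A^*I_2A=I_2,\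 \det A=1\}$ with $I_2=\mathrm{diag}(-1,-1,1,1,1,1)$. *)

theory Defs
  imports "HOL-Analysis.Analysis" "HOL-Algebra.Bij" "HOL-Algebra.Coset"
begin

section \<open>Quaternions over a commutative ring\<close>

text \<open>
  The algebra \<open>'a quat\<close> is free over \<open>'a\<close> on the basis \<open>1, e\<^sub>1, e\<^sub>2, e\<^sub>3\<close>, with
  \<open>e\<^sub>k\<^sup>2 = -1\<close> and \<open>e\<^sub>1 e\<^sub>2 = e\<^sub>3 = - e\<^sub>2 e\<^sub>1\<close> (and cyclically).  Thus \<open>real quat\<close> is the
  quaternion algebra \<open>H\<close>, and its complexification \<open>H \<otimes> C\<close> is the scalar extension
  \<open>complex quat\<close>, whose central unit \<open>\<i>\<close> is unrelated to \<open>e\<^sub>1\<close>.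
\<close>

datatype 'a quat = Quat (q0: 'a) (q1: 'a) (q2: 'a) (q3: 'a)

lemma quat_eq_iff: "x = y \<longleftrightarrow> q0 x = q0 y \<and> q1 x = q1 y \<and> q2 x = q2 y \<and> q3 x = q3 y"
  by (cases x; cases y) simp

instantiation quat :: (comm_ring_1) ring_1
begin

definition "0 = Quat 0 0 0 0"
definition "1 = Quat 1 0 0 0"
definition "x + y = Quat (q0 x + q0 y) (q1 x + q1 y) (q2 x + q2 y) (q3 x + q3 y)"
definition "x - y = Quat (q0 x - q0 y) (q1 x - q1 y) (q2 x - q2 y) (q3 x - q3 y)"
definition "- x = Quat (- q0 x) (- q1 x) (- q2 x) (- q3 x)"
definition "x * y = Quat
  (q0 x * q0 y - q1 x * q1 y - q2 x * q2 y - q3 x * q3 y)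
  (q0 x * q1 y + q1 x * q0 y + q2 x * q3 y - q3 x * q2 y)
  (q0 x * q2 y + q2 x * q0 y + q3 x * q1 y - q1 x * q3 y)
  (q0 x * q3 y + q3 x * q0 y + q1 x * q2 y - q2 x * q1 y)"

instance
  by standard
    (simp_all add: zero_quat_def one_quat_def plus_quat_def minus_quat_def uminus_quat_def
      times_quat_def algebra_simps)

end

lemmas quat_defs = zero_quat_def one_quat_def plus_quat_def minus_quat_def uminus_quat_def
  times_quat_def

definition quat_of :: "'a::comm_ring_1 \<Rightarrow> 'a quat"
  where "quat_of c = Quat c 0 0 0"

definition qcnj :: "'a::comm_ring_1 quat \<Rightarrow> 'a quat"
  where "qcnj x = Quat (q0 x) (- q1 x) (- q2 x) (- q3 x)"

lemma qcnj_mult: "qcnj (x * y) = qcnj y * qcnj x"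
  by (simp add: qcnj_def times_quat_def algebra_simps)

lemma quat_of_central: "quat_of c * x = x * quat_of c"
  by (simp add: quat_of_def times_quat_def algebra_simps)

text \<open>Complex conjugation on the second factor of \<open>H \<otimes> C\<close>, fixing \<open>e\<^sub>1, e\<^sub>2, e\<^sub>3\<close>.\<close>

definition qtau :: "complex quat \<Rightarrow> complex quat"
  where "qtau = map_quat cnj"


section \<open>The Jordan algebra of Hermitian matrices\<close>

type_synonym quat_mat = "complex quat^3^3"

definition qadjoint :: "quat_mat \<Rightarrow> quat_mat"
  where "qadjoint X = map_matrix qcnj (transpose X)"

definition J3 :: "quat_mat set"
  where "J3 = {X. qadjoint X = X}"

definition scaleC :: "complex \<Rightarrow> quat_mat \<Rightarrow> quat_mat"  (infixr \<open>*\<^sub>C\<close> 75)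
  where "c *\<^sub>C X = map_matrix ((*) (quat_of c)) X"

text \<open>
  The coordinates of \<open>X\<close> are \<open>\<xi>\<^sub>i = X\<^sub>i\<^sub>i\<close>, \<open>x\<^sub>1 = X\<^sub>2\<^sub>3\<close>, \<open>x\<^sub>2 = X\<^sub>3\<^sub>1\<close> and \<open>x\<^sub>3 = X\<^sub>1\<^sub>2\<close>.  On \<open>J3\<close> the
  expression below is a scalar, so \<open>q0\<close> only changes its type; see \<open>quat_of_jdet\<close>.
\<close>

definition jdet :: "quat_mat \<Rightarrow> complex"
  where "jdet X =
    q0 (X$1$1 * X$2$2 * X$3$3
        + X$2$3 * X$3$1 * X$1$2 + qcnj (X$2$3 * X$3$1 * X$1$2)
        - (X$1$1 * (X$2$3 * qcnj (X$2$3))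
           + X$2$2 * (X$3$1 * qcnj (X$3$1))
           + X$3$3 * (X$1$2 * qcnj (X$1$2))))"

text \<open>Here too \<open>q0\<close> only changes the type on \<open>J3\<close>; see \<open>quat_of_jinner\<close>.\<close>

definition jinner :: "quat_mat \<Rightarrow> quat_mat \<Rightarrow> complex"
  where "jinner X Y = q0 (trace ((1/2) *\<^sub>C (X ** Y + Y ** X)))"

definition I1 :: quat_mat
  where "I1 = (\<chi> i j. if i = j then if i = 1 then -1 else 1 else 0)"

definition sigma :: "quat_mat \<Rightarrow> quat_mat"
  where "sigma X = I1 ** X ** I1"

definition tau :: "quat_mat \<Rightarrow> quat_mat"
  where "tau = map_matrix qtau"

definition herm_sigma :: "quat_mat \<Rightarrow> quat_mat \<Rightarrow> complex"
  where "herm_sigma X Y = jinner (tau (sigma X)) Y"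

lemma J3_iff:
  "X \<in> J3 \<longleftrightarrow>
     q1 (X$1$1) = 0 \<and> q2 (X$1$1) = 0 \<and> q3 (X$1$1) = 0 \<and>
     q1 (X$2$2) = 0 \<and> q2 (X$2$2) = 0 \<and> q3 (X$2$2) = 0 \<and>
     q1 (X$3$3) = 0 \<and> q2 (X$3$3) = 0 \<and> q3 (X$3$3) = 0 \<and>
     X$2$1 = qcnj (X$1$2) \<and> X$1$3 = qcnj (X$3$1) \<and> X$3$2 = qcnj (X$2$3)"
  by (auto simp: J3_def qadjoint_def transpose_def vec_eq_iff forall_3 qcnj_def quat_eq_iff)

lemma J3_zero: "0 \<in> J3"
  by (simp add: J3_iff qcnj_def zero_quat_def)

lemma J3_add: "X \<in> J3 \<Longrightarrow> Y \<in> J3 \<Longrightarrow> X + Y \<in> J3"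
  by (simp add: J3_iff qcnj_def plus_quat_def)

lemma J3_scaleC: "X \<in> J3 \<Longrightarrow> c *\<^sub>C X \<in> J3"
  by (simp add: J3_iff scaleC_def quat_of_def qcnj_def times_quat_def)

lemma J3_sigma: "X \<in> J3 \<Longrightarrow> sigma X \<in> J3"
  by (simp add: J3_iff sigma_def I1_def matrix_matrix_mult_def sum_3 quat_defs qcnj_def)

lemma J3_tau: "X \<in> J3 \<Longrightarrow> tau X \<in> J3"
  by (simp add: J3_iff tau_def qtau_def qcnj_def quat.map_sel)

lemma quat_of_jdet:
  assumes "X \<in> J3"
  shows "quat_of (jdet X) =
    X$1$1 * X$2$2 * X$3$3
    + X$2$3 * X$3$1 * X$1$2 + qcnj (X$2$3 * X$3$1 * X$1$2)
    - (X$1$1 * (X$2$3 * qcnj (X$2$3))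
       + X$2$2 * (X$3$1 * qcnj (X$3$1))
       + X$3$3 * (X$1$2 * qcnj (X$1$2)))"
  using assms by (simp add: J3_iff jdet_def quat_of_def qcnj_def quat_defs algebra_simps)

lemma quat_of_jinner:
  assumes "X \<in> J3" "Y \<in> J3"
  shows "quat_of (jinner X Y) = trace ((1/2) *\<^sub>C (X ** Y + Y ** X))"
  using assms
  by (simp add: J3_iff jinner_def quat_of_def scaleC_def trace_def matrix_matrix_mult_def sum_3
      qcnj_def quat_defs algebra_simps)


section \<open>The two groups\<close>

text \<open>
  A \<open>C\<close>-linear automorphism of \<open>J3\<close> is represented by its extension with value \<open>undefined\<close>
  outside \<open>J3\<close>, as required by \<open>Bij\<close>, so that distinct functions are distinct automorphisms.
\<close>

definition Iso_C_J3 :: "(quat_mat \<Rightarrow> quat_mat) set"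
  where "Iso_C_J3 = {\<alpha> \<in> Bij J3.
    (\<forall>X\<in>J3. \<forall>Y\<in>J3. \<alpha> (X + Y) = \<alpha> X + \<alpha> Y) \<and>
    (\<forall>c. \<forall>X\<in>J3. \<alpha> (c *\<^sub>C X) = c *\<^sub>C \<alpha> X)}"

definition E6_m14_H :: "(quat_mat \<Rightarrow> quat_mat) monoid"
  where "E6_m14_H = (BijGroup J3)\<lparr>carrier := {\<alpha> \<in> Iso_C_J3.
    (\<forall>X\<in>J3. jdet (\<alpha> X) = jdet X) \<and>
    (\<forall>X\<in>J3. \<forall>Y\<in>J3. herm_sigma (\<alpha> X) (\<alpha> Y) = herm_sigma X Y)}\<rparr>"

definition cadjoint :: "complex^6^6 \<Rightarrow> complex^6^6"
  where "cadjoint A = map_matrix cnj (transpose A)"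

definition I2 :: "complex^6^6"
  where "I2 = (\<chi> i j. if i = j then if i \<in> {1, 2} then -1 else 1 else 0)"

definition SU_2_4 :: "(complex^6^6) monoid"
  where "SU_2_4 =
    \<lparr>carrier = {A. cadjoint A ** I2 ** A = I2 \<and> det A = 1}, mult = (**), one = mat 1\<rparr>"

lemma group_E6_m14_H: "group E6_m14_H"
proof -
  interpret B: group "BijGroup J3" by (rule group_BijGroup)
  let ?S = "carrier E6_m14_H"
  have mem: "\<alpha> X \<in> J3" if "\<alpha> \<in> Bij J3" "X \<in> J3" for \<alpha> X
    using that Bij_imp_funcset by blast
  have "subgroup ?S (BijGroup J3)"
  proof (rule B.subgroupI)
    show "?S \<subseteq> carrier (BijGroup J3)"
      by (auto simp: E6_m14_H_def Iso_C_J3_def BijGroup_def)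
    have "(\<lambda>X\<in>J3. X) \<in> ?S"
      by (auto simp: E6_m14_H_def Iso_C_J3_def id_Bij J3_add J3_scaleC)
    then show "?S \<noteq> {}" by blast
  next
    fix \<alpha> \<beta> assume "\<alpha> \<in> ?S" "\<beta> \<in> ?S"
    then show "\<alpha> \<otimes>\<^bsub>BijGroup J3\<^esub> \<beta> \<in> ?S"
      by (auto simp: E6_m14_H_def Iso_C_J3_def BijGroup_def compose_Bij compose_eq mem
          J3_add J3_scaleC)
  next
    fix \<alpha> assume a: "\<alpha> \<in> ?S"
    define \<beta> where "\<beta> = (\<lambda>X\<in>J3. inv_into J3 \<alpha> X)"
    from a have bij: "\<alpha> \<in> Bij J3" by (simp add: E6_m14_H_def Iso_C_J3_def)
    have \<beta>: "\<beta> \<in> Bij J3" unfolding \<beta>_def by (rule restrict_inv_into_Bij[OF bij])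
    have \<alpha>\<beta>: "\<alpha> (\<beta> X) = X" if "X \<in> J3" for X
      using bij that by (auto simp: \<beta>_def Bij_def bij_betw_def f_inv_into_f)
    have \<beta>\<alpha>: "\<beta> (\<alpha> X) = X" if "X \<in> J3" for X
      using bij that mem[OF bij that] by (auto simp: \<beta>_def Bij_def bij_betw_def)
    have "\<beta> (X + Y) = \<beta> X + \<beta> Y" if "X \<in> J3" "Y \<in> J3" for X Y
    proof -
      have "\<alpha> (\<beta> X + \<beta> Y) = X + Y"
        using a that mem[OF \<beta>] by (simp add: E6_m14_H_def Iso_C_J3_def \<alpha>\<beta>)
      then show ?thesis
        using \<beta>\<alpha>[of "\<beta> X + \<beta> Y"] that mem[OF \<beta>] by (simp add: J3_add)
    qed
    moreover have "\<beta> (c *\<^sub>C X) = c *\<^sub>C \<beta> X" if "X \<in> J3" for c X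
    proof -
      have "\<alpha> (c *\<^sub>C \<beta> X) = c *\<^sub>C X"
        using a that mem[OF \<beta>] by (simp add: E6_m14_H_def Iso_C_J3_def \<alpha>\<beta>)
      then show ?thesis
        using \<beta>\<alpha>[of "c *\<^sub>C \<beta> X"] that mem[OF \<beta>] by (simp add: J3_scaleC)
    qed
    moreover have "jdet (\<beta> X) = jdet X" if "X \<in> J3" for X
    proof -
      have "jdet (\<alpha> (\<beta> X)) = jdet (\<beta> X)"
        using a that mem[OF \<beta>] by (simp add: E6_m14_H_def)
      then show ?thesis using \<alpha>\<beta>[OF that] by simp
    qed
    moreover have "herm_sigma (\<beta> X) (\<beta> Y) = herm_sigma X Y" if "X \<in> J3" "Y \<in> J3" for X Y
    proof -
      have "herm_sigma (\<alpha> (\<beta> X)) (\<alpha> (\<beta> Y)) = herm_sigma (\<beta> X) (\<beta> Y)"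
        using a that mem[OF \<beta>] by (simp add: E6_m14_H_def)
      then show ?thesis using \<alpha>\<beta> that by simp
    qed
    ultimately have "\<beta> \<in> ?S"
      using \<beta> by (simp add: E6_m14_H_def Iso_C_J3_def)
    moreover have "inv\<^bsub>BijGroup J3\<^esub> \<alpha> = \<beta>"
      unfolding \<beta>_def by (rule inv_BijGroup[OF bij])
    ultimately show "inv\<^bsub>BijGroup J3\<^esub> \<alpha> \<in> ?S" by simp
  qed
  then have "group ((BijGroup J3)\<lparr>carrier := ?S\<rparr>)"
    by (rule subgroup.subgroup_is_group) (rule group_BijGroup)
  then show ?thesis by (simp add: E6_m14_H_def)
qed

lemma cadjoint_mult: "cadjoint (A ** B) = cadjoint B ** cadjoint A"
  by (simp add: cadjoint_def matrix_matrix_mult_def transpose_def vec_eq_iff mult.commute)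

lemma cadjoint_mat_1: "cadjoint (mat 1) = mat 1"
  by (auto simp: cadjoint_def mat_def transpose_def vec_eq_iff)

lemma group_SU_2_4: "group SU_2_4"
proof (rule groupI)
  fix A B assume "A \<in> carrier SU_2_4" "B \<in> carrier SU_2_4"
  then have A: "cadjoint A ** I2 ** A = I2" "det A = 1"
    and B: "cadjoint B ** I2 ** B = I2" "det B = 1"
    by (simp_all add: SU_2_4_def)
  have "cadjoint (A ** B) ** I2 ** (A ** B) = cadjoint B ** (cadjoint A ** I2 ** A) ** B"
    by (simp add: cadjoint_mult matrix_mul_assoc)
  then show "A \<otimes>\<^bsub>SU_2_4\<^esub> B \<in> carrier SU_2_4"
    using A B by (simp add: SU_2_4_def det_mul)
next
  fix A assume "A \<in> carrier SU_2_4"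
  then have A: "cadjoint A ** I2 ** A = I2" "det A = 1"
    by (simp_all add: SU_2_4_def)
  then have "invertible A" by (simp add: invertible_det_nz)
  then obtain B where AB: "A ** B = mat 1" and BA: "B ** A = mat 1"
    by (auto simp: invertible_def)
  have "cadjoint B ** I2 ** B = cadjoint B ** (cadjoint A ** I2 ** A) ** B"
    by (simp add: A)
  also have "\<dots> = cadjoint (A ** B) ** I2 ** (A ** B)"
    by (simp add: cadjoint_mult matrix_mul_assoc)
  also have "\<dots> = I2" by (simp add: AB cadjoint_mat_1)
  finally have "cadjoint B ** I2 ** B = I2" .
  moreover have "det B = 1"
    using arg_cong[OF AB, of det] A by (simp add: det_mul)
  ultimately show "\<exists>B\<in>carrier SU_2_4. B \<otimes>\<^bsub>SU_2_4\<^esub> A = \<one>\<^bsub>SU_2_4\<^esub>"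
    using BA by (auto simp: SU_2_4_def)
qed (auto simp: SU_2_4_def matrix_mul_assoc cadjoint_mat_1)

lemma normal_Z2: "{mat 1, - mat 1} \<lhd> SU_2_4"
proof -
  interpret group SU_2_4 by (rule group_SU_2_4)
  have neg_l: "- A ** B = - (A ** B)" and neg_r: "A ** - B = - (A ** B)"
    for A B :: "complex^6^6"
    by (simp_all add: matrix_matrix_mult_def vec_eq_iff sum_negf)
  have cneg: "cadjoint (- A) = - cadjoint A" for A
    by (simp add: cadjoint_def transpose_def vec_eq_iff)
  have "det (- mat 1 :: complex^6^6) = det (mat 1 :: complex^6^6)"
  proof -
    have "- mat 1 = (\<chi> i. (- 1 :: complex) *s (mat 1 :: complex^6^6) $ i)"
      by (simp add: vec_eq_iff)
    then show ?thesis
      using det_rows_mul[of "\<lambda>_. - 1 :: complex" "\<lambda>i. (mat 1 :: complex^6^6) $ i"] by simp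
  qed
  then have in_SU: "- mat 1 \<in> carrier SU_2_4" "mat 1 \<in> carrier SU_2_4"
    by (simp_all add: SU_2_4_def neg_l neg_r cneg cadjoint_mat_1)
  have inv: "inv\<^bsub>SU_2_4\<^esub> (- mat 1) = - mat 1" "inv\<^bsub>SU_2_4\<^esub> (mat 1) = mat 1"
    using in_SU by (auto intro!: inv_equality) (simp_all add: SU_2_4_def neg_l neg_r)
  have "subgroup {mat 1, - mat 1} SU_2_4"
    by (rule subgroupI) (use in_SU inv in \<open>auto simp: SU_2_4_def neg_l neg_r\<close>)
  then show ?thesis
    by (rule normalI)
      (auto simp: r_coset_def l_coset_def SU_2_4_def neg_l neg_r)
qed

end

theory Submission
  imports Defs
begin

text \<open>
  Writing \<open>H \<otimes> C\<close> as the algebra of complex \<open>2 \<times> 2\<close> matrices identifies \<open>J3\<close> with the skew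
  \<open>6 \<times> 6\<close> matrices \<open>K\<close>, the bivectors of \<open>C\<^sup>6\<close>.  Then \<open>jdet\<close> is the Pfaffian, \<open>herm_sigma\<close> is the form
  induced on bivectors by \<open>I2\<close>, and a matrix \<open>A\<close> in \<open>SU(2,4)\<close> acts by \<open>K \<mapsto> A K A\<^sup>t\<close>.
  Conversely, a linear automorphism that preserves the Pfaffian preserves its polarisation, hence
  the relation \<open>X \<and> Y = 0\<close>, and in particular the decomposable bivectors, that is, the planes of
  \<open>C\<^sup>6\<close>, and the relation that two planes meet.  The images of the planes of \<open>e\<^sub>i \<and> e\<^sub>j\<close>, for \<open>i\<close> fixed, therefore
  have a common line, and suitable vectors on these six lines are the columns of an \<open>A\<close> that
  induces the automorphism.  The Pfaffian forces \<open>det A = 1\<close>, and the Hermitian form forces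
  \<open>A\<^sup>* I2 A = \<plusminus> I2\<close>, where the negative sign contradicts the signature.
\<close>

section \<open>Bivectors\<close>

definition smul :: "complex \<Rightarrow> complex^'n^'n \<Rightarrow> complex^'n^'n"  (infixr \<open>*\<^sub>m\<close> 75)
  where "c *\<^sub>m K = (\<chi> i j. c * K$i$j)"

definition skew_mat :: "complex^'n^'n \<Rightarrow> bool"
  where "skew_mat K \<longleftrightarrow> (\<forall>i j. K$i$j = - K$j$i)"

definition wedge :: "complex^'n \<Rightarrow> complex^'n \<Rightarrow> complex^'n^'n"
  where "wedge u v = (\<chi> i j. u$i * v$j - u$j * v$i)"

text \<open>For skew \<open>X\<close> and \<open>Y\<close> this is the coefficient of
  \<open>e_i \<and> e_j \<and> e_k \<and> e_l\<close> in the 4-vector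
  \<open>X \<and> Y\<close>.\<close>

definition wedge4 :: "complex^'n^'n \<Rightarrow> complex^'n^'n \<Rightarrow> 'n \<Rightarrow> 'n \<Rightarrow> 'n \<Rightarrow> 'n \<Rightarrow> complex"
  where "wedge4 X Y i j k l = X$i$j * Y$k$l - X$i$k * Y$j$l + X$i$l * Y$j$k
    + Y$i$j * X$k$l - Y$i$k * X$j$l + Y$i$l * X$j$k"

definition wedge_zero :: "complex^'n^'n \<Rightarrow> complex^'n^'n \<Rightarrow> bool"
  where "wedge_zero X Y \<longleftrightarrow> (\<forall>i j k l. wedge4 X Y i j k l = 0)"

text \<open>For nonzero \<open>X\<close> this says that \<open>X\<close> is decomposable and that
  \<open>v\<close> is a nonzero vector of its plane.\<close>

definition divides_biv :: "complex^'n \<Rightarrow> complex^'n^'n \<Rightarrow> bool"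
  where "divides_biv v X \<longleftrightarrow> (\<exists>w. X = wedge v w)"

lemma smul_nth [simp]: "(c *\<^sub>m K)$i$j = c * K$i$j"
  by (simp add: smul_def)

lemma wedge_nth [simp]: "wedge u v $i$j = u$i * v$j - u$j * v$i"
  by (simp add: wedge_def)

lemma smul_0 [simp]: "0 *\<^sub>m K = 0" "c *\<^sub>m (0::complex^'n^'n) = 0"
  by (simp_all add: vec_eq_iff)

lemma smul_1 [simp]: "1 *\<^sub>m K = K"
  by (simp add: vec_eq_iff)

lemma skew_mat_0 [simp]: "skew_mat 0"
  by (simp add: skew_mat_def)

lemma skew_mat_wedge [simp]: "skew_mat (wedge u v)"
  by (simp add: skew_mat_def)

lemma skew_mat_smul [simp]: "skew_mat X \<Longrightarrow> skew_mat (c *\<^sub>m X)"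
proof -
  assume X: "skew_mat X"
  have "c * X$i$j = - (c * X$j$i)" for i j
    by (subst X[unfolded skew_mat_def, rule_format, of i j]) simp
  then show ?thesis unfolding skew_mat_def smul_nth by blast
qed

lemma skew_mat_add [simp]: "skew_mat X \<Longrightarrow> skew_mat Y \<Longrightarrow> skew_mat (X + Y)"
proof -
  assume "skew_mat X" "skew_mat Y"
  then have "X$i$j = - X$j$i" "Y$i$j = - Y$j$i" for i j
    unfolding skew_mat_def by blast+
  then have "X$i$j + Y$i$j = - (X$j$i + Y$j$i)" for i j
    by (metis minus_add_distrib)
  then show ?thesis unfolding skew_mat_def vector_add_component by blast
qed

lemma skew_mat_diag: "skew_mat K \<Longrightarrow> K$i$i = 0"
proof -
  assume "skew_mat K"
  then have "K$i$i = - K$i$i" unfolding skew_mat_def by blast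
  then show ?thesis by (simp add: eq_neg_iff_add_eq_0 flip: mult_2)
qed

lemma wedge_swap: "wedge v u = (-1) *\<^sub>m wedge u v"
  by (simp add: vec_eq_iff)

lemma wedge_eq_0E:
  assumes "wedge u v = 0"
  obtains s t where "s \<noteq> 0 \<or> t \<noteq> 0" "s *s u + t *s v = 0"
proof (cases "u = 0")
  case True
  then show ?thesis using that[of 1 0] by simp
next
  case False
  then obtain i where i: "u$i \<noteq> 0" by (auto simp: vec_eq_iff)
  have "u$i * v$j = u$j * v$i" for j
    using assms by (simp add: vec_eq_iff)
  then have "v$i *s u + (- u$i) *s v = 0"
    by (simp add: vec_eq_iff mult.commute)
  then show ?thesis using that[of "v$i" "- u$i"] i by auto
qed

lemma wedge_eq_0_parallel:
  assumes "wedge u v = 0" "u \<noteq> 0"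
  obtains t where "v = t *s u"
proof -
  obtain i where i: "u$i \<noteq> 0" using assms(2) by (auto simp: vec_eq_iff)
  have "u$i * v$j = u$j * v$i" for j
    using assms by (simp add: vec_eq_iff)
  then have "v = (v$i / u$i) *s u"
    using i by (simp add: vec_eq_iff field_simps)
  then show ?thesis by (rule that)
qed

section \<open>Vectors in the plane of a bivector\<close>

lemma nonzero_biv:
  fixes X :: "complex^'n^'n"
  assumes "X \<noteq> 0" obtains i j where "X$i$j \<noteq> 0"
  using assms by (auto simp: vec_eq_iff)

text \<open>Exchange: \<open>v\<close> replaces one of \<open>a\<close> and \<open>b\<close> that
  occurs in it with a nonzero coefficient.\<close>

lemma divides_comb:
  assumes "v \<noteq> 0" "v = s *s a + t *s b"
  shows "divides_biv v (wedge a b)"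
proof (cases "s = 0")
  case True
  then have "t \<noteq> 0" using assms by auto
  then have "wedge a b = wedge v ((-1/t) *s a)"
    using True assms(2) by (simp add: vec_eq_iff)
  then show ?thesis by (auto simp: divides_biv_def)
next
  case False
  then have "wedge a b = wedge v ((1/s) *s b)"
    using assms(2) by (simp add: vec_eq_iff field_simps)
  then show ?thesis by (auto simp: divides_biv_def)
qed

lemma divides_span:
  assumes "divides_biv r (wedge p q)" "wedge p q \<noteq> 0"
  obtains s t where "r = s *s p + t *s q"
proof -
  obtain w where w: "wedge p q = wedge r w" using assms by (auto simp: divides_biv_def)
  obtain i j where D: "wedge p q$i$j \<noteq> 0" using nonzero_biv assms by metis
  \<comment> \<open>This is \<open>r \<and> (r \<and> w) = 0\<close> in the coordinates
    \<open>k\<close>, \<open>i\<close>, \<open>j\<close>; it determines \<open>r$k\<close> because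
    \<open>wedge p q$i$j\<close> is nonzero.\<close>
  have e: "r$k * wedge p q$i$j = r$i * wedge p q$k$j + r$j * wedge p q$i$k" for k
    unfolding w by (simp add: algebra_simps)
  have "r$k * wedge p q$i$j = (r$i * q$j - r$j * q$i) * p$k + (r$j * p$i - r$i * p$j) * q$k" for k
    using e[of k] unfolding wedge_nth by algebra
  then have "r = ((r$i * q$j - r$j * q$i) / wedge p q$i$j) *s p
      + ((r$j * p$i - r$i * p$j) / wedge p q$i$j) *s q"
    using D by (simp add: vec_eq_iff add_divide_distrib[symmetric] eq_divide_eq del: wedge_nth)
  then show ?thesis by (rule that)
qed

text \<open>With \<open>X = wedge p w\<close>, the vector \<open>q\<close> is a combination of
  \<open>p\<close> and \<open>w\<close>, and its coefficient at \<open>w\<close> is the factor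
  between the two bivectors.\<close>

lemma two_divisors:
  assumes "divides_biv p X" "divides_biv q X" "wedge p q \<noteq> 0"
  obtains c where "X = c *\<^sub>m wedge p q"
proof (cases "X = 0")
  case True
  then show ?thesis using that[of 0] by simp
next
  case False
  obtain w where w: "X = wedge p w" using assms by (auto simp: divides_biv_def)
  obtain s t where q: "q = s *s p + t *s w"
    using divides_span[of q p w] assms w False by metis
  then have pq: "wedge p q = t *\<^sub>m wedge p w"
    by (simp add: vec_eq_iff algebra_simps)
  then have "t \<noteq> 0" using assms by auto
  then have "X = (1/t) *\<^sub>m wedge p q" unfolding pq w by (simp add: vec_eq_iff)
  then show ?thesis by (rule that)
qed

text \<open>A bivector with vanishing square is, up to a factor, the wedge of any two of its rows that
  meet in a nonzero entry.\<close>

lemma decomposable: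
  assumes "skew_mat X" "wedge_zero X X"
  obtains u v where "X = wedge u v"
proof (cases "X = 0")
  case True
  then show ?thesis using that[of 0 0] by (simp add: vec_eq_iff)
next
  case False
  then obtain i j where D: "X$i$j \<noteq> 0" using nonzero_biv by metis
  have "wedge4 X X i j k l = 2 * (X$i$j * X$k$l - X$i$k * X$j$l + X$i$l * X$j$k)" for k l
    by (simp add: wedge4_def algebra_simps)
  then have e: "X$i$j * X$k$l - X$i$k * X$j$l + X$i$l * X$j$k = 0" for k l
    using assms(2) unfolding wedge_zero_def by (metis mult_eq_0_iff zero_neq_numeral)
  have "X$i$j * X$k$l = X$i$k * X$j$l - X$i$l * X$j$k" for k l
    using e[of k l] by algebra
  then have "X = wedge (X$i) ((1 / X$i$j) *s X$j)"
    using D by (simp add: vec_eq_iff field_simps)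
  then show ?thesis by (rule that)
qed

text \<open>The reduction of \<open>c\<close> and \<open>d\<close> modulo the plane of \<open>a\<close> and \<open>b\<close> leaves two parallel vectors,
  and a relation between these is a common vector of both planes.\<close>

lemma common_divisor:
  assumes "wedge a b \<noteq> 0" "wedge c d \<noteq> 0" "wedge_zero (wedge a b) (wedge c d)"
  obtains v where "v \<noteq> 0" "divides_biv v (wedge a b)" "divides_biv v (wedge c d)"
proof -
  let ?X = "wedge a b"
  obtain i j where D: "?X$i$j \<noteq> 0" using nonzero_biv assms by metis
  \<comment> \<open>Column \<open>j\<close> and row \<open>i\<close> of \<open>?X\<close> lie in the
    plane of \<open>a\<close> and \<open>b\<close>; subtracting them from a multiple of
    \<open>x\<close> in this way kills the coordinates \<open>i\<close> and
    \<open>j\<close>.\<close>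
  define r where "r x = (\<chi> k. ?X$i$j * x$k - x$i * ?X$k$j - x$j * ?X$i$k)" for x
  have "wedge (r c) (r d) $k$l = ?X$i$j * wedge4 ?X (wedge c d) i j k l" for k l
    unfolding r_def wedge4_def by (simp add: algebra_simps)
  then have "wedge (r c) (r d) = 0"
    using assms(3) by (simp add: vec_eq_iff wedge_zero_def del: wedge_nth)
  then obtain s t where st: "s \<noteq> 0 \<or> t \<noteq> 0" "s *s r c + t *s r d = 0"
    by (rule wedge_eq_0E)
  define v where "v = s *s c + t *s d"
  have v0: "v \<noteq> 0"
  proof
    assume "v = 0"
    then have *: "s * c$k = - (t * d$k)" for k
      by (simp add: v_def vec_eq_iff eq_neg_iff_add_eq_0)
    have "s * (wedge c d$k$l) = 0" "t * (wedge c d$k$l) = 0" for k l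
    proof -
      have "s * (wedge c d$k$l) = (s * c$k) * d$l - (s * c$l) * d$k" by (simp add: algebra_simps)
      then show "s * (wedge c d$k$l) = 0" unfolding * by simp
      have "t * (wedge c d$k$l) = c$k * (t * d$l) - c$l * (t * d$k)" by (simp add: algebra_simps)
      also have "\<dots> = - c$k * (s * c$l) + c$l * (s * c$k)" unfolding * by simp
      finally show "t * (wedge c d$k$l) = 0" by simp
    qed
    then show False using st(1) assms(2) by (auto simp: vec_eq_iff)
  qed
  have "r v = s *s r c + t *s r d"
    by (simp add: r_def v_def vec_eq_iff algebra_simps)
  \<comment> \<open>\<open>r v = 0\<close> exhibits \<open>v\<close> as a combination of column
    \<open>j\<close> and row \<open>i\<close> of \<open>?X\<close>, hence of \<open>a\<close> and
    \<open>b\<close>.\<close>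
  then have e: "?X$i$j * v$k = v$i * ?X$k$j + v$j * ?X$i$k" for k
    using st(2) by (simp add: r_def vec_eq_iff algebra_simps del: wedge_nth)
  have "v$k * ?X$i$j = (v$i * b$j - v$j * b$i) * a$k + (v$j * a$i - v$i * a$j) * b$k" for k
    using e[of k] unfolding wedge_nth by algebra
  then have "v = ((v$i * b$j - v$j * b$i) / ?X$i$j) *s a
      + ((v$j * a$i - v$i * a$j) / ?X$i$j) *s b"
    using D by (simp add: vec_eq_iff add_divide_distrib[symmetric] eq_divide_eq del: wedge_nth)
  then show ?thesis
    using that[OF v0] divides_comb[OF v0] v_def by blast
qed

lemma common_divisor':
  assumes "skew_mat X" "skew_mat Y" "X \<noteq> 0" "Y \<noteq> 0"
    "wedge_zero X X" "wedge_zero Y Y" "wedge_zero X Y"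
  obtains v where "v \<noteq> 0" "divides_biv v X" "divides_biv v Y"
proof -
  obtain a b where X: "X = wedge a b" by (rule decomposable[OF assms(1,5)])
  obtain c d where Y: "Y = wedge c d" by (rule decomposable[OF assms(2,6)])
  show ?thesis
    using common_divisor[of a b c d] assms(3,4,7) that unfolding X Y by blast
qed

lemma wedge_zero_common:
  assumes "divides_biv v X" "divides_biv v Y"
  shows "wedge_zero X Y"
proof -
  obtain w z where "X = wedge v w" "Y = wedge v z"
    using assms by (auto simp: divides_biv_def)
  then show ?thesis by (simp add: wedge_zero_def wedge4_def algebra_simps)
qed

text \<open>If \<open>a\<close> did not divide \<open>X4\<close>, the planes of \<open>X2\<close>, \<open>X3\<close> and \<open>X4\<close> would be the sides of a triangle, and
  the fourth plane, which meets all of them, would lie in the \<open>3\<close>-space of that triangle.\<close>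

lemma four_meeting_planes:
  fixes X2 :: "complex^'n^'n"
  assumes skew: "skew_mat X2" "skew_mat X3" "skew_mat X4" "skew_mat X5"
    and sq: "wedge_zero X2 X2" "wedge_zero X3 X3" "wedge_zero X4 X4" "wedge_zero X5 X5"
    and mt: "wedge_zero X2 X4" "wedge_zero X3 X4" "wedge_zero X2 X5" "wedge_zero X3 X5"
      "wedge_zero X4 X5"
    and ind: "\<And>s t u v. s *\<^sub>m X2 + t *\<^sub>m X3 + u *\<^sub>m X4 + v *\<^sub>m X5 = 0 \<Longrightarrow>
      s = 0 \<and> t = 0 \<and> u = 0 \<and> v = 0"
    and a: "a \<noteq> 0" "divides_biv a X2" "divides_biv a X3"
  shows "divides_biv a X4"
proof (rule ccontr)
  assume a4: "\<not> divides_biv a X4"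
  have nz: "X2 \<noteq> 0" "X3 \<noteq> 0" "X4 \<noteq> 0" "X5 \<noteq> 0"
    using ind[of 1 0 0 0] ind[of 0 1 0 0] ind[of 0 0 1 0] ind[of 0 0 0 1] by auto
  have ind23: False if "X2 = s *\<^sub>m B" "X3 = t *\<^sub>m B" for s t B
  proof -
    have "t *\<^sub>m X2 + (-s) *\<^sub>m X3 + 0 *\<^sub>m X4 + 0 *\<^sub>m X5 = 0"
      by (simp add: that vec_eq_iff)
    then have "s = 0" using ind by fastforce
    then show False using nz that by simp
  qed
  have no5: False if "X5 = s *\<^sub>m X2 + t *\<^sub>m X3 + u *\<^sub>m X4" for s t u
  proof -
    have "s *\<^sub>m X2 + t *\<^sub>m X3 + u *\<^sub>m X4 + (-1) *\<^sub>m X5 = 0"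
      by (simp add: that vec_eq_iff)
    then show False using ind by fastforce
  qed
  have parallel: "divides_biv a Y" if h: "divides_biv p Y" "wedge a p = 0" for p Y
  proof -
    obtain t where "p = t *s a" by (rule wedge_eq_0_parallel[OF h(2) a(1)])
    moreover obtain w where "Y = wedge p w" using h by (auto simp: divides_biv_def)
    ultimately have "Y = wedge a (t *s w)" by (simp add: vec_eq_iff)
    then show ?thesis by (auto simp: divides_biv_def)
  qed
  obtain p where p: "p \<noteq> 0" "divides_biv p X2" "divides_biv p X4"
    by (rule common_divisor'[OF skew(1,3) nz(1,3) sq(1,3) mt(1)])
  obtain q where q: "q \<noteq> 0" "divides_biv q X3" "divides_biv q X4"
    by (rule common_divisor'[OF skew(2,3) nz(2,3) sq(2,3) mt(2)])
  have ap: "wedge a p \<noteq> 0" and aq: "wedge a q \<noteq> 0"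
    using parallel p q a4 by blast+
  obtain s2 where X2: "X2 = s2 *\<^sub>m wedge a p" by (rule two_divisors[OF a(2) p(2) ap])
  obtain s3 where X3: "X3 = s3 *\<^sub>m wedge a q" by (rule two_divisors[OF a(3) q(2) aq])
  have s: "s2 \<noteq> 0" "s3 \<noteq> 0" using nz X2 X3 by auto
  have pq: "wedge p q \<noteq> 0"
  proof
    assume "wedge p q = 0"
    then obtain t where "q = t *s p" by (rule wedge_eq_0_parallel[OF _ p(1)])
    then have "X3 = (s3 * t) *\<^sub>m wedge a p" by (simp add: X3 vec_eq_iff algebra_simps)
    then show False using ind23[OF X2] by blast
  qed
  obtain s4 where X4: "X4 = s4 *\<^sub>m wedge p q" by (rule two_divisors[OF p(3) q(3) pq])
  have s4: "s4 \<noteq> 0" using nz X4 by auto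
  \<comment> \<open>\<open>X2\<close>, \<open>X3\<close> and \<open>X4\<close> span the bivectors of
    the space spanned by \<open>a\<close>, \<open>p\<close> and \<open>q\<close>, so by independence
    \<open>X5\<close> is not one of them.\<close>
  have in_U: False if "X5 = x *\<^sub>m wedge a p + y *\<^sub>m wedge a q + z *\<^sub>m wedge p q" for x y z
  proof (rule no5)
    show "X5 = (x/s2) *\<^sub>m X2 + (y/s3) *\<^sub>m X3 + (z/s4) *\<^sub>m X4"
      using s s4 by (simp add: that X2 X3 X4 vec_eq_iff)
  qed
  have spanX: "\<exists>x y. r = x *s u + y *s w"
    if h: "divides_biv r Y" "Y = c *\<^sub>m wedge u w" "c \<noteq> 0" "wedge u w \<noteq> 0" for r Y c u w
  proof -
    obtain z where "Y = wedge r z" using h by (auto simp: divides_biv_def)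
    then have "wedge u w = wedge r ((1/c) *s z)"
      using h by (simp add: vec_eq_iff field_simps)
    then have "divides_biv r (wedge u w)" by (auto simp: divides_biv_def)
    then show ?thesis using divides_span[of r u w] h by metis
  qed
  show False
  \<comment> \<open>The plane of \<open>X5\<close> is spanned by \<open>a\<close> and a vector of
    \<open>X4\<close>, or else by a vector of \<open>X2\<close> and one of \<open>X3\<close>. Either
    way it lies in the span of \<open>a\<close>, \<open>p\<close> and \<open>q\<close>.\<close>
  proof (cases "divides_biv a X5")
    case True
    obtain r where r: "r \<noteq> 0" "divides_biv r X4" "divides_biv r X5"
      by (rule common_divisor'[OF skew(3,4) nz(3,4) sq(3,4) mt(5)])
    have ar: "wedge a r \<noteq> 0" using r parallel a4 by blast
    obtain c where c: "X5 = c *\<^sub>m wedge a r" by (rule two_divisors[OF True r(3) ar])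
    obtain x y where "r = x *s p + y *s q" using spanX[OF r(2) X4 s4 pq] by blast
    then have "X5 = (c*x) *\<^sub>m wedge a p + (c*y) *\<^sub>m wedge a q + 0 *\<^sub>m wedge p q"
      by (simp add: c vec_eq_iff algebra_simps)
    then show False by (rule in_U)
  next
    case a5: False
    obtain p' where p': "p' \<noteq> 0" "divides_biv p' X2" "divides_biv p' X5"
      by (rule common_divisor'[OF skew(1,4) nz(1,4) sq(1,4) mt(3)])
    obtain q' where q': "q' \<noteq> 0" "divides_biv q' X3" "divides_biv q' X5"
      by (rule common_divisor'[OF skew(2,4) nz(2,4) sq(2,4) mt(4)])
    have pq': "wedge p' q' \<noteq> 0"
    proof
      assume "wedge p' q' = 0"
      then obtain t where t: "q' = t *s p'" by (rule wedge_eq_0_parallel[OF _ p'(1)])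
      obtain w where "X3 = wedge q' w" using q' by (auto simp: divides_biv_def)
      then have "X3 = wedge p' (t *s w)" by (simp add: t vec_eq_iff)
      then have p3: "divides_biv p' X3" by (auto simp: divides_biv_def)
      have ap': "wedge a p' \<noteq> 0" using parallel a5 p' by blast
      obtain x where x: "X2 = x *\<^sub>m wedge a p'" by (rule two_divisors[OF a(2) p'(2) ap'])
      obtain y where y: "X3 = y *\<^sub>m wedge a p'" by (rule two_divisors[OF a(3) p3 ap'])
      show False by (rule ind23[OF x y])
    qed
    obtain c where c: "X5 = c *\<^sub>m wedge p' q'" by (rule two_divisors[OF p'(3) q'(3) pq'])
    obtain x y where pp: "p' = x *s a + y *s p" using spanX[OF p'(2) X2 s(1) ap] by blast
    obtain z w where qq: "q' = z *s a + w *s q" using spanX[OF q'(2) X3 s(2) aq] by blast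
    have "X5 = (-c*y*z) *\<^sub>m wedge a p + (c*x*w) *\<^sub>m wedge a q + (c*y*w) *\<^sub>m wedge p q"
      by (simp add: c pp qq vec_eq_iff algebra_simps)
    then show False by (rule in_U)
  qed
qed

section \<open>Linear maps preserving incidence of planes\<close>

lemma ex_fresh_index:
  fixes i j k l :: "'n::finite"
  assumes "5 \<le> CARD('n)"
  obtains m where "m \<noteq> i" "m \<noteq> j" "m \<noteq> k" "m \<noteq> l"
proof -
  have card4: "card {i, j, k, l} \<le> 4"
    by (simp add: card_insert_if)
  have "{i, j, k, l} \<noteq> UNIV"
  proof
    assume "{i, j, k, l} = UNIV"
    then show False using card4 assms by simp
  qed
  then show ?thesis using that by blast
qed

abbreviation unit_biv :: "'n \<Rightarrow> 'n \<Rightarrow> complex^'n^'n"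
  where "unit_biv i j \<equiv> wedge (axis i 1) (axis j 1)"

lemma skew_mat_sum: "(\<And>x. x \<in> S \<Longrightarrow> skew_mat (f x)) \<Longrightarrow> skew_mat (sum f S)"
  by (induction S rule: infinite_finite_induct) auto

lemma sum_sum_delta:
  fixes f :: "'n::finite \<Rightarrow> 'n \<Rightarrow> complex"
  shows "(\<Sum>i\<in>UNIV. \<Sum>j\<in>UNIV. (if k = i then if l = j then f i j else 0 else 0)) = f k l"
proof -
  have "(\<Sum>j\<in>UNIV. (if k = i then if l = j then f i j else 0 else 0)) = (if k = i then f i l else 0)" for i
    by simp
  then show ?thesis by simp
qed

text \<open>The sum over ordered pairs meets each basis bivector twice, whence the division by
  2.\<close>

lemma skew_mat_expand:
  assumes "skew_mat K"
  shows "K = (\<Sum>(i, j)\<in>UNIV. (K$i$j / 2) *\<^sub>m unit_biv i j)"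
proof -
  have "(\<Sum>(i, j)\<in>UNIV. (K$i$j / 2) *\<^sub>m unit_biv i j)$k$l = K$k$l" for k l
  proof -
    have "(\<Sum>(i, j)\<in>UNIV. (K$i$j / 2) *\<^sub>m unit_biv i j)$k$l
      = (\<Sum>i\<in>UNIV. \<Sum>j\<in>UNIV. (K$i$j / 2) * unit_biv i j$k$l)"
      by (simp add: sum.cartesian_product split_def del: wedge_nth)
    also have "\<dots> = (\<Sum>i\<in>UNIV. \<Sum>j\<in>UNIV. (if k = i then if l = j then K$i$j / 2 else 0 else 0))
      - (\<Sum>i\<in>UNIV. \<Sum>j\<in>UNIV. (if l = i then if k = j then K$i$j / 2 else 0 else 0))"
      unfolding sum_subtractf[symmetric]
      by (intro sum.cong refl) (auto simp: axis_def)
    also have "(\<Sum>i\<in>UNIV. \<Sum>j\<in>UNIV. (if k = i then if l = j then K$i$j / 2 else 0 else 0)) = K$k$l / 2"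
      by (rule sum_sum_delta)
    also have "(\<Sum>i\<in>UNIV. \<Sum>j\<in>UNIV. (if l = i then if k = j then K$i$j / 2 else 0 else 0)) = K$l$k / 2"
      by (rule sum_sum_delta)
    also have "K$l$k = - K$k$l" using assms unfolding skew_mat_def by blast
    finally show ?thesis by simp
  qed
  then show ?thesis by (simp add: vec_eq_iff)
qed

lemma congruence_nth:
  fixes A K :: "complex^'n^'n"
  shows "(A ** K ** transpose A)$k$l = (\<Sum>i\<in>UNIV. \<Sum>j\<in>UNIV. A$k$i * K$i$j * A$l$j)"
  unfolding matrix_matrix_mult_def transpose_def
  by (simp add: sum_distrib_right) (rule sum.swap)

text \<open>Five indices give four independent bivectors \<open>unit_biv i j\<close> with
  \<open>i\<close> fixed. In dimension 4 the Hodge star meets all other assumptions but is no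
  congruence.\<close>

locale wedge_preserver =
  fixes \<beta> :: "complex^'n^'n \<Rightarrow> complex^'n^'n"
  assumes card_ge_5: "5 \<le> CARD('n)"
    and skew: "skew_mat K \<Longrightarrow> skew_mat (\<beta> K)"
    and add: "skew_mat K \<Longrightarrow> skew_mat L \<Longrightarrow> \<beta> (K + L) = \<beta> K + \<beta> L"
    and smul: "skew_mat K \<Longrightarrow> \<beta> (c *\<^sub>m K) = c *\<^sub>m \<beta> K"
    and inj: "skew_mat K \<Longrightarrow> \<beta> K = 0 \<Longrightarrow> K = 0"
    and wedge_zero_iff: "skew_mat K \<Longrightarrow> skew_mat L \<Longrightarrow>
      wedge_zero (\<beta> K) (\<beta> L) \<longleftrightarrow> wedge_zero K L"
begin

abbreviation X :: "'n \<Rightarrow> 'n \<Rightarrow> complex^'n^'n"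
  where "X i j \<equiv> \<beta> (unit_biv i j)"

lemma sum: "(\<And>x. x \<in> S \<Longrightarrow> skew_mat (f x)) \<Longrightarrow> \<beta> (sum f S) = (\<Sum>x\<in>S. \<beta> (f x))"
proof (induction S rule: infinite_finite_induct)
  case (infinite S)
  have "\<beta> 0 = 0" using smul[of 0 0] by simp
  with infinite show ?case by simp
next
  case empty
  have "\<beta> 0 = 0" using smul[of 0 0] by simp
  then show ?case by simp
next
  case (insert x S)
  then show ?case by (simp add: add skew_mat_sum)
qed

lemma X_swap: "X j i = (-1) *\<^sub>m X i j"
  by (metis smul skew_mat_wedge wedge_swap)

lemma wedge_zero_X: "wedge_zero (X i j) (X i k)"
proof -
  have "wedge_zero (unit_biv i j) (unit_biv i k)"
    by (rule wedge_zero_common[of "axis i 1"]) (auto simp: divides_biv_def)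
  then show ?thesis by (simp add: wedge_zero_iff)
qed

lemma X_nonzero:
  assumes "i \<noteq> j"
  shows "X i j \<noteq> 0"
proof
  assume "X i j = 0"
  then have "unit_biv i j = 0" using inj by simp
  then have "unit_biv i j$i$j = 0" by simp
  then show False using assms by (simp add: axis_def)
qed

lemma wedge4_unit_biv:
  assumes "distinct [i, j, k, l]"
  shows "wedge4 (unit_biv i j) (unit_biv k l) i j k l = 1"
  using assms by (auto simp: wedge4_def axis_def)

lemma not_wedge_zero_X:
  assumes "distinct [i, j, k, l]"
  shows "\<not> wedge_zero (X i j) (X k l)"
proof -
  have "\<not> wedge_zero (unit_biv i j) (unit_biv k l)"
    using wedge4_unit_biv[OF assms] unfolding wedge_zero_def by (metis zero_neq_one)
  then show ?thesis by (simp add: wedge_zero_iff)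
qed

lemma X_independent:
  assumes "distinct [i, j, k, l, m]"
    and "s *\<^sub>m X i j + t *\<^sub>m X i k + u *\<^sub>m X i l + v *\<^sub>m X i m = 0"
  shows "s = 0 \<and> t = 0 \<and> u = 0 \<and> v = 0"
proof -
  let ?K = "s *\<^sub>m unit_biv i j + t *\<^sub>m unit_biv i k + u *\<^sub>m unit_biv i l + v *\<^sub>m unit_biv i m"
  have "\<beta> ?K = 0" using assms(2) by (simp add: add smul)
  then have "?K = 0" using inj by simp
  then have "?K$i$j = 0" "?K$i$k = 0" "?K$i$l = 0" "?K$i$m = 0" by simp_all
  then show ?thesis using assms(1) by (auto simp: axis_def)
qed

text \<open>Two of the planes determine \<open>a\<close>. A third one, \<open>X i l\<close>,
  contains it by \<open>four_meeting_planes\<close>, where a fifth index \<open>m\<close> supplies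
  the auxiliary fourth plane.\<close>

lemma common_vector: "\<exists>a. a \<noteq> 0 \<and> (\<forall>l. l \<noteq> i \<longrightarrow> divides_biv a (X i l))"
proof -
  obtain j where j: "j \<noteq> i" using ex_fresh_index[OF card_ge_5] by blast
  obtain k where k: "k \<noteq> i" "k \<noteq> j" using ex_fresh_index[OF card_ge_5] by blast
  obtain a where a: "a \<noteq> 0" "divides_biv a (X i j)" "divides_biv a (X i k)"
    by (rule common_divisor'[OF skew[OF skew_mat_wedge] skew[OF skew_mat_wedge]
          X_nonzero[OF j[symmetric]] X_nonzero[OF k(1)[symmetric]]
          wedge_zero_X wedge_zero_X wedge_zero_X])
  have "divides_biv a (X i l)" if l: "l \<noteq> i" "l \<noteq> j" "l \<noteq> k" for l
  proof -
    obtain m where m: "m \<noteq> i" "m \<noteq> j" "m \<noteq> k" "m \<noteq> l"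
      using ex_fresh_index[OF card_ge_5] by blast
    have d: "distinct [i, j, k, l, m]" using j k l m by auto
    show ?thesis
      by (rule four_meeting_planes[OF skew skew skew skew wedge_zero_X wedge_zero_X wedge_zero_X
            wedge_zero_X wedge_zero_X wedge_zero_X wedge_zero_X wedge_zero_X wedge_zero_X
            X_independent[OF d] a]) simp_all
  qed
  then show ?thesis using a by metis
qed

text \<open>The common vectors \<open>a i\<close> determine \<open>X i j\<close> up to scalars
  \<open>c i j\<close>. The main work is to factor these as \<open>d i * d j\<close>; then the
  vectors \<open>d i *s a i\<close> are the columns of \<open>A\<close>.\<close>

theorem is_congruence: "\<exists>A. \<forall>K. skew_mat K \<longrightarrow> \<beta> K = A ** K ** transpose A"
proof -
  obtain a where a0: "\<And>i. a i \<noteq> 0" and a: "\<And>i l. l \<noteq> i \<Longrightarrow> divides_biv (a i) (X i l)"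
    using common_vector by metis
  have a': "divides_biv (a j) (X i j)" if ij: "i \<noteq> j" for i j
  proof -
    obtain w where "X j i = wedge (a j) w" using a[OF ij] by (auto simp: divides_biv_def)
    then have "X i j = wedge (a j) ((-1) *s w)" unfolding X_swap[of i j] by (simp add: vec_eq_iff)
    then show ?thesis by (auto simp: divides_biv_def)
  qed
  \<comment> \<open>If \<open>a i\<close> and \<open>a j\<close> were parallel, \<open>X i k\<close>
    and \<open>X j l\<close> would share a vector, although \<open>unit_biv i k\<close> and
    \<open>unit_biv j l\<close> have a nonzero product.\<close>
  have aa: "wedge (a i) (a j) \<noteq> 0" if ij: "i \<noteq> j" for i j
  proof
    assume "wedge (a i) (a j) = 0"
    then obtain t where t: "a j = t *s a i" by (rule wedge_eq_0_parallel[OF _ a0])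
    obtain k where k: "k \<noteq> i" "k \<noteq> j" using ex_fresh_index[OF card_ge_5] by blast
    obtain l where l: "l \<noteq> i" "l \<noteq> j" "l \<noteq> k" using ex_fresh_index[OF card_ge_5] by blast
    obtain w where "X j l = wedge (a j) w" using a[OF l(2)] by (auto simp: divides_biv_def)
    then have "X j l = wedge (a i) (t *s w)" by (simp add: t vec_eq_iff)
    then have "divides_biv (a i) (X j l)" by (auto simp: divides_biv_def)
    then have "wedge_zero (X i k) (X j l)" by (rule wedge_zero_common[OF a[OF k(1)]])
    moreover have "distinct [i, k, j, l]" using ij k l by auto
    ultimately show False using not_wedge_zero_X by blast
  qed
  have "\<exists>c. X i j = c *\<^sub>m wedge (a i) (a j)" if ij: "i \<noteq> j" for i j
    using two_divisors[OF a[OF ij[symmetric]] a'[OF ij] aa[OF ij]] by blast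
  then obtain c where c: "\<And>i j. i \<noteq> j \<Longrightarrow> X i j = c i j *\<^sub>m wedge (a i) (a j)" by metis
  have c0: "c i j \<noteq> 0" if "i \<noteq> j" for i j
    using X_nonzero[OF that] c[OF that] by auto
  have c_sym: "c i j = c j i" if ij: "i \<noteq> j" for i j
  proof -
    obtain k l where kl: "wedge (a i) (a j)$k$l \<noteq> 0" using nonzero_biv[OF aa[OF ij]] by blast
    have "X j i$k$l = - X i j$k$l" unfolding X_swap[of j i] by simp
    then have "c j i * wedge (a j) (a i)$k$l = - (c i j * wedge (a i) (a j)$k$l)"
      unfolding c[OF ij] c[OF ij[symmetric]] smul_nth .
    then have "c j i * wedge (a i) (a j)$k$l = c i j * wedge (a i) (a j)$k$l"
      by (simp add: algebra_simps)
    then show ?thesis using kl by (simp del: wedge_nth)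
  qed
  \<comment> \<open>The bivector \<open>?Y\<close> is decomposable, so its image has square zero;
    the part of that square along the product of \<open>a i\<close>, \<open>a k\<close>,
    \<open>a j\<close> and \<open>a l\<close> is this relation.\<close>
  have ratio: "c i k * c j l = c i l * c j k" if d: "distinct [i, j, k, l]" for i j k l
  proof -
    let ?Y = "wedge (axis i 1 + axis j 1) (axis k 1 + axis l 1) :: complex^'n^'n"
    have "?Y = unit_biv i k + unit_biv i l + unit_biv j k + unit_biv j l"
      by (simp add: vec_eq_iff algebra_simps)
    then have "\<beta> ?Y = X i k + X i l + X j k + X j l"
      by (simp add: add)
    also have "\<dots> = c i k *\<^sub>m wedge (a i) (a k) + c i l *\<^sub>m wedge (a i) (a l)
      + c j k *\<^sub>m wedge (a j) (a k) + c j l *\<^sub>m wedge (a j) (a l)" (is "_ = ?Z")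
      using d by (simp add: c)
    finally have YZ: "\<beta> ?Y = ?Z" .
    have "wedge_zero ?Y ?Y"
      by (rule wedge_zero_common[of "axis i 1 + axis j 1"]) (auto simp: divides_biv_def)
    then have z: "wedge_zero ?Z ?Z"
      unfolding YZ[symmetric] by (simp add: wedge_zero_iff)
    have "\<not> wedge_zero (X i k) (X j l)" using d by (intro not_wedge_zero_X) auto
    then obtain p q r s where n: "wedge4 (X i k) (X j l) p q r s \<noteq> 0"
      by (auto simp: wedge_zero_def)
    have "wedge4 (X i k) (X j l) p q r s
      = c i k * c j l * wedge4 (wedge (a i) (a k)) (wedge (a j) (a l)) p q r s"
      using d by (simp add: c wedge4_def algebra_simps)
    with n have n': "wedge4 (wedge (a i) (a k)) (wedge (a j) (a l)) p q r s \<noteq> 0" by auto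
    have "wedge4 ?Z ?Z p q r s = 2 * (c i k * c j l - c i l * c j k)
      * wedge4 (wedge (a i) (a k)) (wedge (a j) (a l)) p q r s"
      unfolding wedge4_def wedge_nth smul_nth vector_add_component by algebra
    then show ?thesis using z n' unfolding wedge_zero_def by simp
  qed
  obtain o' :: 'n where True by blast
  obtain p where p: "p \<noteq> o'" using ex_fresh_index[OF card_ge_5] by blast
  obtain q where q: "q \<noteq> o'" "q \<noteq> p" using ex_fresh_index[OF card_ge_5] by blast
  \<comment> \<open>A factorisation \<open>c i j = d i * d j\<close> forces the square of
    \<open>d o'\<close> to be this quotient; the choice of a root fixes all other
    \<open>d i\<close>.\<close>
  define e where "e = csqrt (c o' p * c o' q / c p q)"
  have e2: "e * e = c o' p * c o' q / c p q"
    unfolding e_def power2_eq_square[symmetric] by simp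
  have e0: "e \<noteq> 0" using e2 c0 p q by auto
  define d where "d i = (if i = o' then e else c o' i / e)" for i
  \<comment> \<open>This is \<open>c i j * (e * e) = c o' i * c o' j\<close> with denominators
    cleared.\<close>
  have key: "c i j * c o' p * c o' q = c o' i * c o' j * c p q"
    if ij: "i \<noteq> o'" "j \<noteq> o'" "i \<noteq> j" for i j
  proof -
    have one: "c p j * c o' q = c o' j * c p q" if "j \<noteq> o'" "j \<noteq> p" for j
      using ratio[of p o' j q] that p q by (cases "j = q") (auto simp: mult.commute)
    have two: "c q j * c o' p = c o' j * c p q" if "j \<noteq> o'" "j \<noteq> q" for j
      using ratio[of q o' j p] c_sym[of q p] that p q by (cases "j = p") (auto simp: mult.commute)
    consider "i = p" | "i = q" | "j = p" | "j = q" | "distinct [o', p, q, i, j]"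
      using ij p q by auto
    then show ?thesis
    proof cases
      case 1 then show ?thesis using one[of j] ij by (simp add: mult.commute mult.left_commute)
    next
      case 2 then show ?thesis using two[of j] ij by (simp add: mult.commute mult.left_commute)
    next
      case 3 then show ?thesis using one[of i] c_sym[of i j] ij
        by (simp add: mult.commute mult.left_commute)
    next
      case 4 then show ?thesis using two[of i] c_sym[of i j] ij
        by (simp add: mult.commute mult.left_commute)
    next
      case 5
      then have "c i j * c o' p = c i p * c o' j" "c i p * c q o' = c i o' * c q p"
        "c q o' = c o' q" "c i o' = c o' i" "c q p = c p q"
        using ratio[of i o' j p] ratio[of i q p o'] c_sym by auto
      then show ?thesis by algebra
    qed
  qed
  have cd: "c i j = d i * d j" if ij: "i \<noteq> j" for i j
  proof -
    consider "i = o'" | "j = o'" | "i \<noteq> o'" "j \<noteq> o'" by blast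
    then show ?thesis
    proof cases
      case 3
      have "d i * d j = c o' i * c o' j / (e * e)" using 3 by (simp add: d_def)
      also have "\<dots> = c o' i * c o' j * c p q / (c o' p * c o' q)" by (simp add: e2)
      also have "\<dots> = c i j" using key[OF 3 ij] c0[of o' p] c0[of o' q] p q
        by (simp add: field_simps)
      finally show ?thesis by simp
    qed (use ij e0 c_sym in \<open>auto simp: d_def\<close>)
  qed
  define A :: "complex^'n^'n" where "A = (\<chi> k i. d i * a i$k)"
  \<comment> \<open>For \<open>i = j\<close> both sides vanish, so the formula can be used in sums
    over all pairs.\<close>
  have X: "X i j = (d i * d j) *\<^sub>m wedge (a i) (a j)" for i j
  proof (cases "i = j")
    case True
    have "unit_biv i i = 0 *\<^sub>m unit_biv i i" by (simp add: vec_eq_iff)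
    then have "X i i = 0" by (metis smul smul_0(1) skew_mat_wedge)
    then show ?thesis using True by (simp add: vec_eq_iff)
  qed (simp add: c cd)
  have "\<beta> K = A ** K ** transpose A" if K: "skew_mat K" for K
  proof -
    have "\<beta> K = (\<Sum>(i, j)\<in>UNIV. (K$i$j / 2) *\<^sub>m X i j)"
      by (subst skew_mat_expand[OF K], subst sum) (auto simp: smul split_def)
    then have "\<beta> K$k$l = (\<Sum>i\<in>UNIV. \<Sum>j\<in>UNIV. (K$i$j / 2) * X i j$k$l)" for k l
      by (simp add: sum.cartesian_product split_def)
    then have "\<beta> K$k$l = (\<Sum>i\<in>UNIV. \<Sum>j\<in>UNIV. A$k$i * K$i$j * A$l$j) / 2
      - (\<Sum>i\<in>UNIV. \<Sum>j\<in>UNIV. A$k$j * K$i$j * A$l$i) / 2" for k l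
      unfolding sum_divide_distrib sum_subtractf[symmetric] X
      by (simp add: A_def algebra_simps)
    \<comment> \<open>Skewness of \<open>K\<close> turns the second term of each wedge into another
      copy of the first, so the two halves add up.\<close>
    moreover have "(\<Sum>i\<in>UNIV. \<Sum>j\<in>UNIV. A$k$j * K$i$j * A$l$i)
      = - (\<Sum>i\<in>UNIV. \<Sum>j\<in>UNIV. A$k$i * K$i$j * A$l$j)" for k l
    proof -
      have s: "K$i$j = - K$j$i" for i j using K unfolding skew_mat_def by blast
      have "(\<Sum>i\<in>UNIV. \<Sum>j\<in>UNIV. A$k$j * K$i$j * A$l$i)
        = (\<Sum>i\<in>UNIV. \<Sum>j\<in>UNIV. A$k$i * K$j$i * A$l$j)"
        by (rule sum.swap)
      also have "\<dots> = (\<Sum>i\<in>UNIV. \<Sum>j\<in>UNIV. - (A$k$i * K$i$j * A$l$j))"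
        by (intro sum.cong refl, subst s) simp
      finally show ?thesis by (simp add: sum_negf)
    qed
    ultimately have "\<beta> K$k$l = (A ** K ** transpose A)$k$l" for k l
      by (simp add: congruence_nth)
    then show ?thesis by (simp add: vec_eq_iff)
  qed
  then show ?thesis by blast
qed

end

section \<open>The Pfaffian\<close>

lemma exhaust_6:
  fixes x :: 6
  shows "x = 1 \<or> x = 2 \<or> x = 3 \<or> x = 4 \<or> x = 5 \<or> x = 6"
proof (induct x)
  case (of_int z)
  \<comment> \<open>In this type the numeral 6 equals 0, so \<open>z = 0\<close> yields the last
    disjunct.\<close>
  then have "z = 0 \<or> z = 1 \<or> z = 2 \<or> z = 3 \<or> z = 4 \<or> z = 5" by fastforce
  then show ?case by auto
qed

lemma forall_6: "(\<forall>i::6. P i) \<longleftrightarrow> P 1 \<and> P 2 \<and> P 3 \<and> P 4 \<and> P 5 \<and> P 6"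
  by (metis exhaust_6)

lemma UNIV_6: "UNIV = {1, 2, 3, 4, 5, 6::6}"
  using exhaust_6 by auto

lemma sum_6: "sum f (UNIV::6 set) = f 1 + f 2 + f 3 + f 4 + f 5 + f 6"
  unfolding UNIV_6 by (simp add: ac_simps)

section \<open>The determinant characterised as an alternating form in the rows\<close>

definition row_upd :: "complex^'n^'n \<Rightarrow> 'n \<Rightarrow> complex^'n \<Rightarrow> complex^'n^'n"
  where "row_upd A i v = (\<chi> k. if k = i then v else A$k)"

definition row_swap :: "complex^'n^'n \<Rightarrow> 'n \<Rightarrow> 'n \<Rightarrow> complex^'n^'n"
  where "row_swap A i j = (\<chi> k. A $ Transposition.transpose i j k)"

lemma row_swap_nth: "row_swap A i j $ k = A $ (if k = i then j else if k = j then i else k)"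
  by (simp add: row_swap_def Transposition.transpose_def)

lemma row_upd_nth: "row_upd A i v $ k = (if k = i then v else A $ k)"
  by (simp add: row_upd_def)

text \<open>Induction on a set \<open>S\<close> containing every row that is not yet the unit vector
  of its position. By linearity a row \<open>s\<close> in \<open>S\<close> becomes some
  \<open>axis k 1\<close>: for \<open>k\<close> outside \<open>S\<close> two rows agree, for
  \<open>k = s\<close> the set shrinks, and otherwise a swap brings the unit vector to row
  \<open>k\<close>.\<close>

lemma alternating_eq_0:
  fixes H :: "complex^'n^'n \<Rightarrow> complex"
  assumes add: "\<And>A i u v. H (row_upd A i (u + v)) = H (row_upd A i u) + H (row_upd A i v)"
    and smult: "\<And>A i c u. H (row_upd A i (c *s u)) = c * H (row_upd A i u)"
    and swap: "\<And>A i j. i \<noteq> j \<Longrightarrow> H (row_swap A i j) = - H A"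
    and one: "H (mat 1) = 0"
  shows "H A = 0"
proof -
  have sum: "H (row_upd A i (\<Sum>k\<in>S. c k *s v k)) = (\<Sum>k\<in>S. c k * H (row_upd A i (v k)))"
    if "finite S" for A i S c and v :: "'n \<Rightarrow> complex^'n"
    using that
  proof induction
    case empty
    then show ?case using smult[of A i 0 0] by simp
  qed (simp add: add smult)
  have "H A = 0" if "\<forall>i. i \<notin> S \<longrightarrow> A$i = axis i 1" for S A
    using that
  proof (induction "card S" arbitrary: S A rule: less_induct)
    case less
    show ?case
    proof (cases "S = {}")
      case True
      then have "A = mat 1"
        using less.prems by (simp add: vec_eq_iff axis_def mat_def eq_commute)
      then show ?thesis using one by simp
    next
      case False
      then obtain s where s: "s \<in> S" by blast
      have smaller: "card (S - {k}) < card S" if "k \<in> S" for k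
        using that by (meson card_Diff1_less finite)
      have "H (row_upd A s (axis k 1)) = 0" for k
      proof -
        let ?B = "row_upd A s (axis k 1)"
        consider "k \<notin> S" | "k = s" | "k \<in> S" "k \<noteq> s" by blast
        then show ?thesis
        proof cases
          case 1
          then have "s \<noteq> k" using s by blast
          moreover have "row_swap ?B s k$i = ?B$i" for i
            using less.prems 1 by (simp add: row_swap_nth row_upd_nth)
          then have "row_swap ?B s k = ?B" by (simp only: vec_eq_iff) simp
          ultimately show ?thesis using swap[of s k ?B] by simp
        next
          case 2
          have "\<forall>i. i \<notin> S - {s} \<longrightarrow> ?B$i = axis i 1"
            using less.prems 2 by (simp add: row_upd_def)
          then show ?thesis using less.hyps[OF smaller[OF s]] by blast
        next
          case 3
          have "row_swap ?B s k$i = axis i 1" if "i \<notin> S - {k}" for i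
          proof (cases "i = k")
            case True
            then show ?thesis using 3 by (simp add: row_swap_nth row_upd_nth)
          next
            case False
            then have "i \<notin> S" "i \<noteq> s" using that s by auto
            then show ?thesis using False less.prems by (simp add: row_swap_nth row_upd_nth)
          qed
          then have "H (row_swap ?B s k) = 0" using less.hyps[OF smaller[OF 3(1)]] by blast
          then show ?thesis using swap[of s k ?B] 3 by simp
        qed
      qed
      moreover have "A = row_upd A s (\<Sum>k\<in>UNIV. A$s$k *s axis k 1)"
        by (simp add: vec_eq_iff row_upd_nth)
          (simp only: basis_expansion vec_eq_iff[symmetric]
            flip: sum_component vector_smult_component)
      ultimately show ?thesis using sum[of UNIV A s "\<lambda>k. A$s$k" "\<lambda>k. axis k 1"] by simp
    qed
  qed
  from this[of UNIV A] show ?thesis by simp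
qed

text \<open>The difference of the two sides is again alternating and vanishes at the
  identity.\<close>

lemma alternating_eq_det:
  fixes H :: "complex^'n^'n \<Rightarrow> complex"
  assumes add: "\<And>A i u v. H (row_upd A i (u + v)) = H (row_upd A i u) + H (row_upd A i v)"
    and smult: "\<And>A i c u. H (row_upd A i (c *s u)) = c * H (row_upd A i u)"
    and swap: "\<And>A i j. i \<noteq> j \<Longrightarrow> H (row_swap A i j) = - H A"
  shows "H A = det A * H (mat 1)"
proof -
  have "H A - det A * H (mat 1) = 0"
  proof (rule alternating_eq_0[where H = "\<lambda>A. H A - det A * H (mat 1)"])
    show "H (row_upd A i (u + v)) - det (row_upd A i (u + v)) * H (mat 1)
      = H (row_upd A i u) - det (row_upd A i u) * H (mat 1)
        + (H (row_upd A i v) - det (row_upd A i v) * H (mat 1))" for A i u v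
    proof -
      have "det (row_upd A i (u + v)) = det (row_upd A i u) + det (row_upd A i v)"
        by (simp add: row_upd_def det_row_add)
      then show ?thesis by (simp add: add algebra_simps)
    qed
    show "H (row_upd A i (c *s u)) - det (row_upd A i (c *s u)) * H (mat 1)
      = c * (H (row_upd A i u) - det (row_upd A i u) * H (mat 1))" for A i c u
    proof -
      have "det (row_upd A i (c *s u)) = c * det (row_upd A i u)"
        by (simp add: row_upd_def det_row_mul)
      then show ?thesis by (simp add: smult algebra_simps)
    qed
    show "H (row_swap A i j) - det (row_swap A i j) * H (mat 1) = - (H A - det A * H (mat 1))"
      if "i \<noteq> j" for A i j
    proof -
      have "det (row_swap A i j) = - det A"
        using that det_permute_rows[of "Transposition.transpose i j" A]
        by (simp add: row_swap_def permutes_swap_id sign_swap_id)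
      then show ?thesis using that by (simp add: swap)
    qed
  qed simp
  then show ?thesis by simp
qed

text \<open>The Pfaffian of a skew matrix, expanded along the first row; only entries above the
  diagonal occur.\<close>

definition pf :: "complex^6^6 \<Rightarrow> complex"
  where "pf K =
    K$1$2 * (K$3$4 * K$5$6 - K$3$5 * K$4$6 + K$3$6 * K$4$5)
    - K$1$3 * (K$2$4 * K$5$6 - K$2$5 * K$4$6 + K$2$6 * K$4$5)
    + K$1$4 * (K$2$3 * K$5$6 - K$2$5 * K$3$6 + K$2$6 * K$3$5)
    - K$1$5 * (K$2$3 * K$4$6 - K$2$4 * K$3$6 + K$2$6 * K$3$4)
    + K$1$6 * (K$2$3 * K$4$5 - K$2$4 * K$3$5 + K$2$5 * K$3$4)"

text \<open>The entries of \<open>A ** K ** transpose A\<close> are the values of a skew bilinear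
  form on pairs of rows of \<open>A\<close>, so its Pfaffian is alternating in these rows and
  therefore a multiple of \<open>det A\<close>.\<close>

lemma pf_congruence:
  assumes K: "skew_mat K"
  shows "pf (A ** K ** transpose A) = det A * pf K"
proof -
  define B where "B u v = (\<Sum>i\<in>UNIV. \<Sum>j\<in>UNIV. u$i * K$i$j * v$j)" for u v :: "complex^6"
  have B_add: "B (u + v) w = B u w + B v w" "B w (u + v) = B w u + B w v" for u v w
    unfolding B_def by (simp_all add: algebra_simps sum.distrib)
  have B_smult: "B (c *s u) w = c * B u w" "B w (c *s u) = c * B w u" for c u w
    unfolding B_def by (simp_all add: algebra_simps sum_distrib_left)
  have s: "K$i$j = - K$j$i" for i j using K unfolding skew_mat_def by blast
  have B_skew: "B v u = - B u v" for u v
  proof -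
    have "B v u = (\<Sum>i\<in>UNIV. \<Sum>j\<in>UNIV. v$j * K$j$i * u$i)"
      unfolding B_def by (rule sum.swap)
    also have "\<dots> = (\<Sum>i\<in>UNIV. \<Sum>j\<in>UNIV. - (u$i * K$i$j * v$j))"
      by (intro sum.cong refl, subst s) simp
    finally show ?thesis by (simp add: B_def sum_negf)
  qed
  define H where "H A = pf (\<chi> i j. B (A$i) (A$j))" for A
  have H: "pf (A ** K ** transpose A) = H A" for A
    unfolding H_def by (rule arg_cong[where f = pf]) (simp add: vec_eq_iff congruence_nth B_def)
  have "H A = det A * H (mat 1)"
  proof (rule alternating_eq_det)
    show "H (row_upd A i (u + v)) = H (row_upd A i u) + H (row_upd A i v)" for A i u v
      using exhaust_6[of i]
      by (elim disjE; hypsubst) (simp_all add: H_def pf_def row_upd_def B_add algebra_simps)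
    show "H (row_upd A i (c *s u)) = c * H (row_upd A i u)" for A i c u
      using exhaust_6[of i]
      by (elim disjE; hypsubst) (simp_all add: H_def pf_def row_upd_def B_smult algebra_simps)
    \<comment> \<open>Only those instances of \<open>B_skew\<close> that put indices in increasing
      order, so that rewriting terminates.\<close>
    have B_sort: "B (A$2) (A$1) = - B (A$1) (A$2)" "B (A$3) (A$1) = - B (A$1) (A$3)"
      "B (A$3) (A$2) = - B (A$2) (A$3)" "B (A$4) (A$1) = - B (A$1) (A$4)"
      "B (A$4) (A$2) = - B (A$2) (A$4)" "B (A$4) (A$3) = - B (A$3) (A$4)"
      "B (A$5) (A$1) = - B (A$1) (A$5)" "B (A$5) (A$2) = - B (A$2) (A$5)"
      "B (A$5) (A$3) = - B (A$3) (A$5)" "B (A$5) (A$4) = - B (A$4) (A$5)"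
      "B (A$6) (A$1) = - B (A$1) (A$6)" "B (A$6) (A$2) = - B (A$2) (A$6)"
      "B (A$6) (A$3) = - B (A$3) (A$6)" "B (A$6) (A$4) = - B (A$4) (A$6)"
      "B (A$6) (A$5) = - B (A$5) (A$6)" for A :: "complex^6^6"
      by (rule B_skew)+
    show "H (row_swap A i j) = - H A" if "i \<noteq> j" for A i j
      using exhaust_6[of i] exhaust_6[of j] that
      by (elim disjE; hypsubst)
        (simp_all add: H_def pf_def row_swap_nth B_sort algebra_simps)
  qed
  then show ?thesis using H[of A] H[of "mat 1"] by (simp add: transpose_mat)
qed

text \<open>The full polarisation of the cubic form \<open>pf\<close>, with
  \<open>pf3 X X X = 6 * pf X\<close>.\<close>

definition pf3 :: "complex^6^6 \<Rightarrow> complex^6^6 \<Rightarrow> complex^6^6 \<Rightarrow> complex"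
  where "pf3 X Y Z = pf (X + Y + Z) - pf (X + Y) - pf (X + Z) - pf (Y + Z) + pf X + pf Y + pf Z"

text \<open>For skew arguments this is the coefficient of \<open>X \<and> Y \<and> Z\<close> in top
  degree, pairing each entry of \<open>Z\<close> with the complementary coefficient of
  \<open>X \<and> Y\<close>.\<close>

lemma pf3_eq:
  "pf3 X Y Z =
    Z$1$2 * wedge4 X Y 3 4 5 6 - Z$1$3 * wedge4 X Y 2 4 5 6 + Z$1$4 * wedge4 X Y 2 3 5 6
    - Z$1$5 * wedge4 X Y 2 3 4 6 + Z$1$6 * wedge4 X Y 2 3 4 5 + Z$2$3 * wedge4 X Y 1 4 5 6
    - Z$2$4 * wedge4 X Y 1 3 5 6 + Z$2$5 * wedge4 X Y 1 3 4 6 - Z$2$6 * wedge4 X Y 1 3 4 5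
    + Z$3$4 * wedge4 X Y 1 2 5 6 - Z$3$5 * wedge4 X Y 1 2 4 6 + Z$3$6 * wedge4 X Y 1 2 4 5
    + Z$4$5 * wedge4 X Y 1 2 3 6 - Z$4$6 * wedge4 X Y 1 2 3 5 + Z$5$6 * wedge4 X Y 1 2 3 4"
  unfolding pf3_def pf_def wedge4_def vector_add_component by algebra

text \<open>The pairing of 4-vectors with bivectors is perfect: taking
  \<open>Z = unit_biv m n\<close> isolates a single coefficient of
  \<open>X \<and> Y\<close>.\<close>

lemma wedge_zero_iff_pf3:
  assumes X: "skew_mat X" and Y: "skew_mat Y"
  shows "wedge_zero X Y \<longleftrightarrow> (\<forall>Z. skew_mat Z \<longrightarrow> pf3 X Y Z = 0)"
proof
  assume "wedge_zero X Y"
  then show "\<forall>Z. skew_mat Z \<longrightarrow> pf3 X Y Z = 0"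
    by (simp add: pf3_eq wedge_zero_def)
next
  assume "\<forall>Z. skew_mat Z \<longrightarrow> pf3 X Y Z = 0"
  then have z: "pf3 X Y (unit_biv m n) = 0" for m n by simp
  \<comment> \<open>\<open>P\<close> forgets the sign, so that transposing two indices becomes a
    plain equality.\<close>
  define P where "P i j k l \<longleftrightarrow> wedge4 X Y i j k l = 0" for i j k l
  have P15: "P 3 4 5 6" "P 2 4 5 6" "P 2 3 5 6" "P 2 3 4 6" "P 2 3 4 5" "P 1 4 5 6" "P 1 3 5 6"
    "P 1 3 4 6" "P 1 3 4 5" "P 1 2 5 6" "P 1 2 4 6" "P 1 2 4 5" "P 1 2 3 6" "P 1 2 3 5" "P 1 2 3 4"
    using z[of 1 2] z[of 1 3] z[of 1 4] z[of 1 5] z[of 1 6] z[of 2 3] z[of 2 4] z[of 2 5] z[of 2 6]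
      z[of 3 4] z[of 3 5] z[of 3 6] z[of 4 5] z[of 4 6] z[of 5 6]
    by (simp_all add: P_def pf3_eq axis_def)
  have s: "X$i$j = - X$j$i" "Y$i$j = - Y$j$i" for i j
    using X Y unfolding skew_mat_def by blast+
  have w1: "wedge4 X Y j i k l = - wedge4 X Y i j k l" for i j k l
    unfolding wedge4_def s[of j i] by (simp add: algebra_simps)
  have P1: "P j i k l = P i j k l" for i j k l
    using w1[of j i k l] by (simp add: P_def)
  have w2: "wedge4 X Y i k j l = - wedge4 X Y i j k l" for i j k l
    unfolding wedge4_def s[of k j] by (simp add: algebra_simps)
  have P2: "P i k j l = P i j k l" for i j k l
    using w2[of i k j l] by (simp add: P_def)
  have w3: "wedge4 X Y i j l k = - wedge4 X Y i j k l" for i j k l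
    unfolding wedge4_def s[of l k] by (simp add: algebra_simps)
  have P3: "P i j l k = P i j k l" for i j k l
    using w3[of i j l k] by (simp add: P_def)
  have P0: "P i i k l" for i k l
    using skew_mat_diag[OF X] skew_mat_diag[OF Y] by (simp add: P_def wedge4_def)
  have P0': "P i j j l" "P i j k k" for i j k l
    using P0 P1 P2 P3 by metis+
  \<comment> \<open>\<open>P1\<close>, \<open>P2\<close> and \<open>P3\<close> are permutative, so ordered rewriting with them sorts the index quadruples.\<close>
  have "\<forall>i j k l. P i j k l"
    using P15 by (simp add: forall_6 P1 P2 P3 P0 P0')
  then show "wedge_zero X Y" by (simp add: wedge_zero_def P_def)
qed

text \<open>\<open>\<beta>\<close> preserves the polarisation \<open>pf3\<close>. By surjectivity
  the third argument runs through all skew matrices, so vanishing of wedge products is preserved in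
  both directions.\<close>

theorem pf_preserver_congruence:
  assumes skew: "\<And>K. skew_mat K \<Longrightarrow> skew_mat (\<beta> K)"
    and add: "\<And>K L. skew_mat K \<Longrightarrow> skew_mat L \<Longrightarrow> \<beta> (K + L) = \<beta> K + \<beta> L"
    and smul: "\<And>c K. skew_mat K \<Longrightarrow> \<beta> (c *\<^sub>m K) = c *\<^sub>m \<beta> K"
    and inj: "\<And>K. skew_mat K \<Longrightarrow> \<beta> K = 0 \<Longrightarrow> K = 0"
    and surj: "\<And>L. skew_mat L \<Longrightarrow> \<exists>K. skew_mat K \<and> \<beta> K = L"
    and pf: "\<And>K. skew_mat K \<Longrightarrow> pf (\<beta> K) = pf K"
  obtains A where "det A = 1" "\<And>K. skew_mat K \<Longrightarrow> \<beta> K = A ** K ** transpose A"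
proof -
  have pf3: "pf3 (\<beta> X) (\<beta> Y) (\<beta> Z) = pf3 X Y Z" if "skew_mat X" "skew_mat Y" "skew_mat Z" for X Y Z
    unfolding pf3_def using that by (simp add: pf flip: add)
  interpret wedge_preserver \<beta>
  proof
    show "wedge_zero (\<beta> K) (\<beta> L) \<longleftrightarrow> wedge_zero K L" if "skew_mat K" "skew_mat L" for K L
    proof -
      have "wedge_zero (\<beta> K) (\<beta> L) \<longleftrightarrow> (\<forall>Z. skew_mat Z \<longrightarrow> pf3 (\<beta> K) (\<beta> L) (\<beta> Z) = 0)"
        using wedge_zero_iff_pf3[OF skew skew] that surj skew by metis
      then show ?thesis using that by (simp add: pf3 wedge_zero_iff_pf3)
    qed
  qed (use skew add smul inj in auto)
  obtain A where A: "\<And>K. skew_mat K \<Longrightarrow> \<beta> K = A ** K ** transpose A"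
    using is_congruence by blast
  \<comment> \<open>A bivector of Pfaffian 1, on which \<open>pf_congruence\<close> reads off
    \<open>det A\<close>.\<close>
  let ?K = "unit_biv 1 2 + unit_biv 3 4 + unit_biv 5 6 :: complex^6^6"
  have "pf ?K = 1" by (simp add: pf_def axis_def)
  then have "det A = 1"
    using pf[of ?K] A[of ?K] pf_congruence[of ?K A] by simp
  then show ?thesis using that A by blast
qed

section \<open>The Jordan algebra as a space of skew matrices\<close>

text \<open>An index of \<open>C^6\<close> is split into its 2 by 2 block, \<open>blk i\<close>, and
  its place there: \<open>even_ix\<close> marks the second place, and \<open>odd_of\<close> and
  \<open>even_of\<close> lead back.\<close>

definition even_ix :: "6 \<Rightarrow> bool"
  where "even_ix i \<longleftrightarrow> i = 2 \<or> i = 4 \<or> i = 6"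

definition blk :: "6 \<Rightarrow> 3"
  where "blk i = (if i = 1 \<or> i = 2 then 1 else if i = 3 \<or> i = 4 then 2 else 3)"

definition odd_of :: "3 \<Rightarrow> 6"
  where "odd_of a = (if a = 1 then 1 else if a = 2 then 3 else 5)"

definition even_of :: "3 \<Rightarrow> 6"
  where "even_of a = (if a = 1 then 2 else if a = 2 then 4 else 6)"

text \<open>
  Under \<open>e\<^sub>1 \<mapsto> diag(\<i>, -\<i>)\<close>, \<open>e\<^sub>2 \<mapsto> J = ((0, 1), (-1, 0))\<close> and \<open>e\<^sub>3 = e\<^sub>1 e\<^sub>2\<close>, conjugation of quaternions
  is the adjugate, so multiplying every \<open>2 \<times> 2\<close> block by \<open>J\<close> on the right turns Hermitian into skew
  matrices.  The flags of \<open>quat_entry\<close> select the second row and the second column of such a block.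
\<close>

definition quat_entry :: "complex quat \<Rightarrow> bool \<Rightarrow> bool \<Rightarrow> complex"
  where "quat_entry x e f =
    (if e then if f then - q2 x + \<i> * q3 x else - (q0 x - \<i> * q1 x)
     else if f then q0 x + \<i> * q1 x else - (q2 x + \<i> * q3 x))"

definition entry_quat :: "complex \<Rightarrow> complex \<Rightarrow> complex \<Rightarrow> complex \<Rightarrow> complex quat"
  where "entry_quat a b c d =
    Quat ((b - c) / 2) ((b + c) / (2 * \<i>)) (- (a + d) / 2) ((d - a) / (2 * \<i>))"

definition phi :: "quat_mat \<Rightarrow> complex^6^6"
  where "phi X = (\<chi> i j. quat_entry (X$blk i$blk j) (even_ix i) (even_ix j))"

definition psi :: "complex^6^6 \<Rightarrow> quat_mat"
  where "psi K = (\<chi> a b. entry_quat (K$odd_of a$odd_of b) (K$odd_of a$even_of b)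
    (K$even_of a$odd_of b) (K$even_of a$even_of b))"

lemma entry_quat_entry: "entry_quat (quat_entry x False False) (quat_entry x False True)
    (quat_entry x True False) (quat_entry x True True) = x"
  by (simp add: entry_quat_def quat_entry_def quat_eq_iff field_simps)

lemma quat_entry_entry:
  "quat_entry (entry_quat a b c d) False False = a" "quat_entry (entry_quat a b c d) False True = b"
  "quat_entry (entry_quat a b c d) True False = c" "quat_entry (entry_quat a b c d) True True = d"
  by (simp_all add: entry_quat_def quat_entry_def field_simps)

text \<open>The identity \<open>adj M * J = - (M * J)^t\<close> for 2 by 2 matrices.\<close>

lemma quat_entry_qcnj: "quat_entry (qcnj x) e f = - quat_entry x f e"
  by (simp add: quat_entry_def qcnj_def)

lemma quat_entry_inject:
  assumes "\<And>e f. quat_entry x e f = quat_entry y e f"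
  shows "x = y"
  by (metis assms entry_quat_entry)

lemma index_simps [simp]:
  "blk (odd_of a) = a" "blk (even_of a) = a" "\<not> even_ix (odd_of a)" "even_ix (even_of a)"
  using exhaust_3[of a] by (auto simp: blk_def odd_of_def even_of_def even_ix_def)

lemma index_even [simp]: "even_ix i \<Longrightarrow> even_of (blk i) = i"
  by (auto simp: blk_def even_of_def even_ix_def)

lemma index_odd [simp]: "\<not> even_ix i \<Longrightarrow> odd_of (blk i) = i"
  using exhaust_6[of i] by (auto simp: blk_def odd_of_def even_ix_def)

lemma psi_phi [simp]: "psi (phi X) = X"
  by (simp add: psi_def phi_def vec_eq_iff entry_quat_entry)

lemma phi_psi [simp]: "phi (psi K) = K"
proof -
  have "phi (psi K)$i$j = K$i$j" for i j
    by (cases "even_ix i"; cases "even_ix j") (simp_all add: psi_def phi_def quat_entry_entry)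
  then show ?thesis by (simp add: vec_eq_iff)
qed

lemma phi_add: "phi (X + Y) = phi X + phi Y"
  by (simp add: phi_def vec_eq_iff quat_entry_def plus_quat_def algebra_simps)

lemma phi_scaleC: "phi (c *\<^sub>C X) = c *\<^sub>m phi X"
  by (simp add: phi_def vec_eq_iff scaleC_def quat_entry_def times_quat_def quat_of_def algebra_simps)

lemma phi_0: "phi 0 = 0"
  by (simp add: phi_def vec_eq_iff quat_entry_def zero_quat_def)

lemma phi_inject: "phi X = phi Y \<longleftrightarrow> X = Y"
  by (metis psi_phi)

lemma J3_iff_entries: "X \<in> J3 \<longleftrightarrow> (\<forall>a b. X$a$b = qcnj (X$b$a))"
  unfolding J3_def qadjoint_def mem_Collect_eq vec_eq_iff[of _ X]
  by (simp add: transpose_def eq_commute vec_eq_iff)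

lemma skew_mat_phi_iff: "skew_mat (phi X) \<longleftrightarrow> X \<in> J3"
proof
  assume "skew_mat (phi X)"
  then have s: "phi X$i$j = - phi X$j$i" for i j unfolding skew_mat_def by blast
  have "quat_entry (X$a$b) e f = quat_entry (qcnj (X$b$a)) e f" for a b e f
    using s[of "if e then even_of a else odd_of a" "if f then even_of b else odd_of b"]
    by (auto simp: phi_def quat_entry_qcnj split: if_splits)
  then show "X \<in> J3"
    unfolding J3_iff_entries by (blast intro: quat_entry_inject)
next
  assume "X \<in> J3"
  then have s: "X$a$b = qcnj (X$b$a)" for a b
    unfolding J3_iff_entries by blast
  have "phi X$i$j = - phi X$j$i" for i j
    using s[of "blk i" "blk j"] by (simp add: phi_def quat_entry_qcnj)
  then show "skew_mat (phi X)" unfolding skew_mat_def by blast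
qed

lemma skew_mat_psi: "skew_mat K \<Longrightarrow> psi K \<in> J3"
  by (metis phi_psi skew_mat_phi_iff)

text \<open>The form induced by \<open>I2\<close> on bivectors: \<open>unit_biv i j\<close> has norm
  -1 exactly when one of two distinct indices lies in \<open>{1, 2}\<close>. The trace counts each
  pair twice, hence the division.\<close>

definition hform :: "complex^6^6 \<Rightarrow> complex^6^6 \<Rightarrow> complex"
  where "hform K L = trace (cadjoint K ** I2 ** L ** I2) / 2"

lemma I2_mult_nth: "(I2 ** K)$i$j = (if i \<in> {1, 2} then - K$i$j else K$i$j)"
  by (simp add: I2_def matrix_matrix_mult_def if_distrib[of "\<lambda>x. x * _"] cong: if_cong)

lemma mult_I2_nth: "(K ** I2)$i$j = (if j \<in> {1, 2} then - K$i$j else K$i$j)"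
  by (simp add: I2_def matrix_matrix_mult_def if_distrib[of "\<lambda>x. _ * x"] cong: if_cong)

lemma I2_I2: "I2 ** I2 = mat 1"
  by (auto simp: vec_eq_iff I2_mult_nth) (auto simp: I2_def mat_def)

lemma transpose_I2: "transpose I2 = I2"
  by (auto simp: vec_eq_iff transpose_def I2_def)

text \<open>The coordinate \<open>X$3$1\<close> sits below the diagonal, so the entries in rows 1, 2
  and columns 5, 6 show its conjugate.\<close>

lemma phi_nth_upper:
  assumes "X \<in> J3"
  shows "phi X$1$2 = q0 (X$1$1)" "phi X$3$4 = q0 (X$2$2)" "phi X$5$6 = q0 (X$3$3)"
    "phi X$1$3 = - (q2 (X$1$2) + \<i> * q3 (X$1$2))" "phi X$1$4 = q0 (X$1$2) + \<i> * q1 (X$1$2)"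
    "phi X$2$3 = - (q0 (X$1$2) - \<i> * q1 (X$1$2))" "phi X$2$4 = - q2 (X$1$2) + \<i> * q3 (X$1$2)"
    "phi X$3$5 = - (q2 (X$2$3) + \<i> * q3 (X$2$3))" "phi X$3$6 = q0 (X$2$3) + \<i> * q1 (X$2$3)"
    "phi X$4$5 = - (q0 (X$2$3) - \<i> * q1 (X$2$3))" "phi X$4$6 = - q2 (X$2$3) + \<i> * q3 (X$2$3)"
    "phi X$1$5 = q2 (X$3$1) + \<i> * q3 (X$3$1)" "phi X$1$6 = q0 (X$3$1) - \<i> * q1 (X$3$1)"
    "phi X$2$5 = - (q0 (X$3$1) + \<i> * q1 (X$3$1))" "phi X$2$6 = q2 (X$3$1) - \<i> * q3 (X$3$1)"
  using assms by (simp_all add: J3_iff phi_def quat_entry_def blk_def even_ix_def qcnj_def)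

lemma pf_phi:
  assumes "X \<in> J3"
  shows "pf (phi X) = jdet X"
proof -
  \<comment> \<open>The only fact about \<open>\<i>\<close> that the polynomial identity below
    requires.\<close>
  have i: "\<i> * \<i> = -1" by simp
  have z: "q1 (X$1$1) = 0" "q2 (X$1$1) = 0" "q3 (X$1$1) = 0" "q1 (X$2$2) = 0" "q2 (X$2$2) = 0"
    "q3 (X$2$2) = 0" "q1 (X$3$3) = 0" "q2 (X$3$3) = 0" "q3 (X$3$3) = 0"
    using assms by (simp_all add: J3_iff)
  show ?thesis
    unfolding pf_def phi_nth_upper[OF assms] jdet_def quat_defs qcnj_def quat.sel z
      mult_zero_left mult_zero_right add_0_right diff_0_right minus_zero
    using i by algebra
qed

lemma hform_skew:
  assumes "skew_mat K" "skew_mat L"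
  shows "hform K L = cnj (K$1$2) * L$1$2 + cnj (K$3$4) * L$3$4 + cnj (K$3$5) * L$3$5
    + cnj (K$3$6) * L$3$6 + cnj (K$4$5) * L$4$5 + cnj (K$4$6) * L$4$6 + cnj (K$5$6) * L$5$6
    - cnj (K$1$3) * L$1$3 - cnj (K$1$4) * L$1$4 - cnj (K$1$5) * L$1$5 - cnj (K$1$6) * L$1$6
    - cnj (K$2$3) * L$2$3 - cnj (K$2$4) * L$2$4 - cnj (K$2$5) * L$2$5 - cnj (K$2$6) * L$2$6"
proof -
  have h: "hform K L = (\<Sum>i\<in>UNIV. \<Sum>j\<in>UNIV. cnj (K$j$i) * (I2 ** L ** I2)$j$i) / 2"
    by (simp add: hform_def trace_def matrix_mul_assoc[symmetric])
       (simp add: matrix_matrix_mult_def cadjoint_def transpose_def)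
  have s: "K$i$j = - K$j$i" "L$i$j = - L$j$i" for i j
    using assms unfolding skew_mat_def by blast+
  show ?thesis
    unfolding h sum_6 I2_mult_nth mult_I2_nth
    by (simp add: skew_mat_diag assms
      s[of 2 1] s[of 3 1] s[of 4 1] s[of 5 1] s[of 6 1] s[of 3 2] s[of 4 2] s[of 5 2] s[of 6 2]
      s[of 4 3] s[of 5 3] s[of 6 3] s[of 5 4] s[of 6 4] s[of 6 5])
qed

lemma herm_sigma_eq:
  assumes "X \<in> J3" "Y \<in> J3"
  shows "herm_sigma X Y = cnj (q0 (X$1$1)) * q0 (Y$1$1) + cnj (q0 (X$2$2)) * q0 (Y$2$2)
    + cnj (q0 (X$3$3)) * q0 (Y$3$3)
    + 2 * (cnj (q0 (X$2$3)) * q0 (Y$2$3) + cnj (q1 (X$2$3)) * q1 (Y$2$3)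
      + cnj (q2 (X$2$3)) * q2 (Y$2$3) + cnj (q3 (X$2$3)) * q3 (Y$2$3))
    - 2 * (cnj (q0 (X$3$1)) * q0 (Y$3$1) + cnj (q1 (X$3$1)) * q1 (Y$3$1)
      + cnj (q2 (X$3$1)) * q2 (Y$3$1) + cnj (q3 (X$3$1)) * q3 (Y$3$1))
    - 2 * (cnj (q0 (X$1$2)) * q0 (Y$1$2) + cnj (q1 (X$1$2)) * q1 (Y$1$2)
      + cnj (q2 (X$1$2)) * q2 (Y$1$2) + cnj (q3 (X$1$2)) * q3 (Y$1$2))"
proof -
  have t: "herm_sigma X Y = (\<Sum>a\<in>UNIV. \<Sum>b\<in>UNIV.
    q0 (tau (sigma X)$a$b * Y$b$a) + q0 (Y$a$b * tau (sigma X)$b$a)) / 2"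
    by (simp add: herm_sigma_def jinner_def trace_def sum_3 matrix_matrix_mult_def scaleC_def
        quat_defs quat_of_def field_simps)
  have u: "tau (sigma X)$a$b = (if (a = 1) = (b = 1) then qtau (X$a$b) else - qtau (X$a$b))" for a b
    using exhaust_3[of a] exhaust_3[of b]
    by (auto simp: tau_def sigma_def I1_def matrix_matrix_mult_def sum_3 quat_defs qtau_def
        quat_eq_iff quat.map_sel)
  show ?thesis
    unfolding t u using assms
    by (simp add: sum_3 J3_iff quat_defs qtau_def quat.map_sel qcnj_def field_simps)
qed

text \<open>Block entries come in pairs such as \<open>q0 + \<i> * q1\<close> and
  \<open>q0 - \<i> * q1\<close>, up to sign; the polarised parallelogram law yields the factor 2 in
  \<open>herm_sigma_eq\<close>.\<close>

lemma hform_phi: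
  assumes "X \<in> J3" "Y \<in> J3"
  shows "hform (phi X) (phi Y) = herm_sigma X Y"
proof -
  have "skew_mat (phi X)" "skew_mat (phi Y)" using assms by (simp_all add: skew_mat_phi_iff)
  then show ?thesis
    by (simp add: hform_skew herm_sigma_eq assms phi_nth_upper algebra_simps)
qed

section \<open>The isomorphism\<close>

lemma skew_mat_iff_transpose: "skew_mat K \<longleftrightarrow> transpose K = - K"
  by (auto simp: skew_mat_def transpose_def vec_eq_iff)

lemma mat_neg_mult: "- A ** B = - (A ** B)" "A ** - B = - (A ** B)"
  for A B :: "complex^'n^'n"
  by (simp_all add: matrix_matrix_mult_def vec_eq_iff sum_negf)

lemma mat_add_mult_right: "(A + B) ** C = A ** C + B ** C" for A B C :: "complex^'n^'n"
  by (simp add: matrix_matrix_mult_def vec_eq_iff sum.distrib algebra_simps)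

lemma mat_diff_mult_left: "C ** (A - B) = C ** A - C ** B" for A B C :: "complex^'n^'n"
  by (simp add: matrix_matrix_mult_def vec_eq_iff sum_subtractf algebra_simps)

lemma skew_mat_congruence:
  fixes A K :: "complex^'n^'n"
  assumes "skew_mat K"
  shows "skew_mat (A ** K ** transpose A)"
  using assms unfolding skew_mat_iff_transpose
  by (simp add: matrix_transpose_mul mat_neg_mult matrix_mul_assoc)

text \<open>Congruence by \<open>A\<close> is the second exterior power of \<open>A\<close>.\<close>

lemma congruence_wedge:
  fixes A :: "complex^'n^'n"
  shows "A ** wedge u v ** transpose A = wedge (A *v u) (A *v v)"
proof -
  have "(A ** wedge u v ** transpose A)$k$l = wedge (A *v u) (A *v v)$k$l" for k l
    unfolding congruence_nth
    by (simp add: matrix_vector_mult_def sum_product sum_subtractf algebra_simps)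
      (rule sum.swap)
  then show ?thesis by (simp add: vec_eq_iff)
qed

text \<open>The column \<open>i\<close> of \<open>N\<close> divides \<open>e\<^sub>i \<and> e\<^sub>j\<close> for all \<open>j\<close>, hence is a multiple of \<open>e\<^sub>i\<close>.\<close>

lemma trivial_congruence:
  fixes N :: "complex^'n^'n"
  assumes card: "5 \<le> CARD('n)"
    and N: "\<And>K. skew_mat K \<Longrightarrow> N ** K ** transpose N = K"
  shows "N = mat 1 \<or> N = - mat 1"
proof -
  have col: "wedge (column i N) (column j N) = unit_biv i j" for i j
  proof -
    have "N *v axis i 1 = column i N" for i
      by (simp add: matrix_vector_mult_def column_def vec_eq_iff axis_def
          if_distrib[of "\<lambda>x. _ * x"] cong: if_cong)
    then show ?thesis using N[of "unit_biv i j"] by (simp add: congruence_wedge)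
  qed
  have off: "N$k$i = 0" if "k \<noteq> i" for i k
  proof -
    obtain j where j: "j \<noteq> i" "j \<noteq> k" using ex_fresh_index[OF card] by blast
    let ?u = "column i N" and ?v = "column j N"
    \<comment> \<open>The relation \<open>u \<and> (u \<and> v) = 0\<close>; once
      \<open>u \<and> v\<close> is known to be \<open>unit_biv i j\<close>, only the first term
      survives.\<close>
    have "?u$k * wedge ?u ?v$i$j + ?u$i * wedge ?u ?v$j$k + ?u$j * wedge ?u ?v$k$i = 0"
      by (simp add: algebra_simps)
    then show ?thesis using j that unfolding col by (simp add: axis_def column_def)
  qed
  have diag: "N$i$i * N$j$j = 1" if ij: "i \<noteq> j" for i j
  proof -
    have "wedge (column i N) (column j N)$i$j = 1"
      unfolding col using ij by (simp add: axis_def)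
    then show ?thesis using off[OF ij] by (simp add: column_def)
  qed
  have same: "N$i$i = N$j$j" for i j
  proof (cases "i = j")
    case False
    obtain k where k: "k \<noteq> i" "k \<noteq> j" using ex_fresh_index[OF card] by blast
    then have "N$i$i * N$k$k = N$j$j * N$k$k" "N$k$k \<noteq> 0"
      using diag[of i k] diag[of j k] by auto
    then show ?thesis by simp
  qed simp
  obtain i :: 'n where True by blast
  obtain j where "j \<noteq> i" using ex_fresh_index[OF card] by blast
  then have "N$i$i * N$i$i = 1" using diag[of i j] same[of i j] by simp
  then have "N$i$i = 1 \<or> N$i$i = -1"
    by (metis power2_eq_1_iff power2_eq_square)
  then have "(\<forall>j. N$j$j = 1) \<or> (\<forall>j. N$j$j = -1)" using same by metis
  then show ?thesis
    using off by (auto simp: vec_eq_iff mat_def)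
qed

section \<open>Congruences preserving the Hermitian form\<close>

lemma card_6_ge_5: "5 \<le> CARD(6)"
  by simp

text \<open>Cyclicity of the trace gathers all factors depending on \<open>A\<close> around
  \<open>L\<close>, where they form the Gram matrix \<open>M A\<close> and its transpose.\<close>

lemma hform_congruence:
  defines "M \<equiv> \<lambda>A. cadjoint A ** I2 ** A"
  shows "hform (A ** K ** transpose A) (A ** L ** transpose A)
    = trace (cadjoint K ** (M A ** L ** transpose (M A))) / 2"
proof -
  define cA where "cA = map_matrix cnj A"
  have 1: "cadjoint (transpose A) = cA" "transpose (cadjoint A) = cA"
    by (simp_all add: cadjoint_def cA_def transpose_def vec_eq_iff)
  have "hform (A ** K ** transpose A) (A ** L ** transpose A)
    = trace (cA ** (cadjoint K ** cadjoint A ** I2 ** A ** L ** transpose A ** I2)) / 2"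
    by (simp add: hform_def cadjoint_mult 1 matrix_mul_assoc)
  also have "\<dots> = trace (cadjoint K ** cadjoint A ** I2 ** A ** L ** transpose A ** I2 ** cA) / 2"
    by (subst trace_mul_sym) simp
  also have "\<dots> = trace (cadjoint K ** (M A ** L ** transpose (M A))) / 2"
    by (simp add: M_def matrix_transpose_mul 1 transpose_I2 matrix_mul_assoc)
  finally show ?thesis .
qed

lemma cnj_mult_self: "cnj z * z = of_real ((cmod z)\<^sup>2)"
  by (metis complex_norm_square mult.commute)

text \<open>The trace is the sum of the squared moduli of the entries of \<open>D\<close>.\<close>

lemma trace_cadjoint_eq_0:
  assumes "trace (cadjoint D ** D) = 0"
  shows "D = 0"
proof -
  have "trace (cadjoint D ** D) = of_real (\<Sum>i\<in>UNIV. \<Sum>k\<in>UNIV. (cmod (D$k$i))\<^sup>2)"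
    by (simp add: trace_def matrix_matrix_mult_def cadjoint_def transpose_def cnj_mult_self
        del: of_real_power)
  then have "(\<Sum>i\<in>UNIV. \<Sum>k\<in>UNIV. (cmod (D$k$i))\<^sup>2) = 0"
    using assms by (metis of_real_eq_0_iff)
  then have "\<forall>i\<in>UNIV. (\<Sum>k\<in>UNIV. (cmod (D$k$i))\<^sup>2) = 0"
    by (subst (asm) sum_nonneg_eq_0_iff) (auto intro: sum_nonneg)
  then have "D$k$i = 0" for i k
    by (auto simp: sum_nonneg_eq_0_iff)
  then show ?thesis by (simp add: vec_eq_iff)
qed

lemma hform_I2: "hform K L = trace (cadjoint K ** (I2 ** L ** I2)) / 2"
  by (simp add: hform_def matrix_mul_assoc)

text \<open>The difference \<open>?D\<close> of the two candidate images of \<open>L\<close> is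
  skew, and testing against \<open>?D\<close> itself shows that it vanishes. Hence
  \<open>I2 ** M\<close> acts trivially on bivectors and is a sign.\<close>

lemma hform_preserved_imp:
  assumes "\<And>K L. skew_mat K \<Longrightarrow> skew_mat L \<Longrightarrow>
    hform (A ** K ** transpose A) (A ** L ** transpose A) = hform K L"
  shows "cadjoint A ** I2 ** A = I2 \<or> cadjoint A ** I2 ** A = - I2"
proof -
  define M where "M = cadjoint A ** I2 ** A"
  have eq: "M ** L ** transpose M = I2 ** L ** I2" if L: "skew_mat L" for L
  proof -
    let ?D = "M ** L ** transpose M - I2 ** L ** I2"
    have "skew_mat (M ** L ** transpose M)" "skew_mat (I2 ** L ** I2)"
      using skew_mat_congruence[OF L, of M] skew_mat_congruence[OF L, of I2]
      by (simp_all add: transpose_I2)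
    then have "skew_mat (M ** L ** transpose M + (-1) *\<^sub>m (I2 ** L ** I2))"
      by simp
    also have "M ** L ** transpose M + (-1) *\<^sub>m (I2 ** L ** I2) = ?D"
      by (simp add: vec_eq_iff)
    finally have D: "skew_mat ?D" .
    have "trace (cadjoint ?D ** (M ** L ** transpose M)) / 2 = trace (cadjoint ?D ** (I2 ** L ** I2)) / 2"
      using assms[OF D L] by (simp only: hform_congruence hform_I2[of ?D L] M_def[symmetric])
    then have "trace (cadjoint ?D ** ?D) = 0"
      by (simp add: mat_diff_mult_left trace_sub)
    then have "?D = 0" by (rule trace_cadjoint_eq_0)
    then show ?thesis by simp
  qed
  have "(I2 ** M) ** L ** transpose (I2 ** M) = L" if L: "skew_mat L" for L
  proof -
    have "(I2 ** M) ** L ** transpose (I2 ** M) = I2 ** (M ** L ** transpose M) ** I2"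
      by (simp add: matrix_transpose_mul transpose_I2 matrix_mul_assoc)
    also have "\<dots> = (I2 ** I2) ** L ** (I2 ** I2)"
      unfolding eq[OF L] by (simp add: matrix_mul_assoc)
    finally show ?thesis by (simp add: I2_I2)
  qed
  then have "I2 ** M = mat 1 \<or> I2 ** M = - mat 1"
    by (rule trivial_congruence[OF card_6_ge_5])
  moreover have "M = I2 ** (I2 ** M)" by (simp add: matrix_mul_assoc I2_I2)
  ultimately have "M = I2 \<or> M = - I2" by (metis mat_neg_mult(2) matrix_mul_rid)
  then show ?thesis by (simp add: M_def)
qed

text \<open>Sylvester's law of inertia for this case: \<open>A\<close> maps the positive \<open>4\<close>-space to a negative one,
  which meets the positive one by a dimension count.\<close>

lemma signature_not_reversed: "cadjoint A ** I2 ** A \<noteq> - I2"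
proof
  assume A: "cadjoint A ** I2 ** A = - I2"
  \<comment> \<open>The first four rows impose that \<open>x\<close> and \<open>A *v x\<close>
    vanish in the coordinates 1 and 2; the two zero rows make \<open>B\<close> singular, so some
    nonzero \<open>x\<close> satisfies this.\<close>
  define B :: "complex^6^6" where "B = (\<chi> i. if i = 1 then axis 1 1 else if i = 2 then axis 2 1
    else if i = 3 then A$1 else if i = 4 then A$2 else 0)"
  have "row 5 B = 0" by (simp add: row_def B_def vec_eq_iff)
  then have "det B = 0" by (rule det_zero_row)
  then have "\<not> (\<exists>C. C ** B = mat 1)"
    by (metis invertible_det_nz invertible_left_inverse)
  then obtain x where x: "B *v x = 0" "x \<noteq> 0"
    unfolding matrix_left_invertible_ker by blast
  define y where "y = A *v x"
  have nth: "(B *v x)$i = (\<Sum>j\<in>UNIV. B$i$j * x$j)" for i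
    by (simp add: matrix_vector_mult_def)
  have x12: "x$1 = 0" "x$2 = 0"
    using x(1) nth[of 1] nth[of 2] by (simp_all add: B_def axis_def sum_6)
  have y12: "y$1 = 0" "y$2 = 0"
    using x(1) nth[of 3] nth[of 4] by (simp_all add: B_def y_def matrix_vector_mult_def)
  have "(\<Sum>k\<in>UNIV. cnj (y$k) * (I2 *v y)$k) = (\<Sum>k\<in>UNIV. \<Sum>i\<in>UNIV. cnj (x$i) * (cnj (A$k$i) * (I2 *v y)$k))"
    unfolding y_def by (simp add: matrix_vector_mult_def[of A x] sum_distrib_left sum_distrib_right algebra_simps)
  also have "\<dots> = (\<Sum>i\<in>UNIV. \<Sum>k\<in>UNIV. cnj (x$i) * (cnj (A$k$i) * (I2 *v y)$k))"
    by (rule sum.swap)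
  also have "\<dots> = (\<Sum>i\<in>UNIV. cnj (x$i) * (cadjoint A *v (I2 *v y))$i)"
  proof -
    have "(cadjoint A *v z)$i = (\<Sum>k\<in>UNIV. cnj (A$k$i) * z$k)" for z i
      by (simp add: matrix_vector_mult_def cadjoint_def transpose_def)
    then show ?thesis by (simp add: sum_distrib_left)
  qed
  also have "cadjoint A *v (I2 *v y) = - (I2 *v x)"
    using A by (simp add: y_def matrix_vector_mul_assoc matrix_mul_assoc)
      (simp add: matrix_vector_mult_def vec_eq_iff sum_negf)
  finally have q: "(\<Sum>k\<in>UNIV. cnj (y$k) * (I2 *v y)$k) = - (\<Sum>k\<in>UNIV. cnj (x$k) * (I2 *v x)$k)"
    by (simp add: sum_negf)
  have I2v: "(\<Sum>k\<in>UNIV. cnj (z$k) * (I2 *v z)$k) = of_real (\<Sum>k\<in>UNIV. (cmod (z$k))\<^sup>2)"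
    if "z$1 = 0" "z$2 = 0" for z
  proof -
    have "cnj (z$k) * (I2 *v z)$k = of_real ((cmod (z$k))\<^sup>2)" for k
      using that exhaust_6[of k]
      by (auto simp: I2_def matrix_vector_mult_def sum_6 cnj_mult_self simp del: of_real_power)
    then show ?thesis by simp
  qed
  have "complex_of_real (\<Sum>k\<in>UNIV. (cmod (y$k))\<^sup>2) = complex_of_real (- (\<Sum>k\<in>UNIV. (cmod (x$k))\<^sup>2))"
    using q unfolding I2v[OF x12] I2v[OF y12] by simp
  then have "(\<Sum>k\<in>UNIV. (cmod (y$k))\<^sup>2) = - (\<Sum>k\<in>UNIV. (cmod (x$k))\<^sup>2)"
    unfolding of_real_eq_iff .
  moreover have "(\<Sum>k\<in>UNIV. (cmod (y$k))\<^sup>2) \<ge> 0" "(\<Sum>k\<in>UNIV. (cmod (x$k))\<^sup>2) \<ge> 0"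
    by (simp_all add: sum_nonneg)
  ultimately have "(\<Sum>k\<in>UNIV. (cmod (x$k))\<^sup>2) = 0" by linarith
  then have "x = 0" by (simp add: sum_nonneg_eq_0_iff vec_eq_iff)
  then show False using x(2) by simp
qed

section \<open>The action of \<open>SU(2,4)\<close> on the Jordan algebra\<close>

definition act :: "complex^6^6 \<Rightarrow> quat_mat \<Rightarrow> quat_mat"
  where "act A = (\<lambda>X\<in>J3. psi (A ** phi X ** transpose A))"

lemma act_mem: "X \<in> J3 \<Longrightarrow> act A X \<in> J3"
  by (simp add: act_def skew_mat_psi skew_mat_congruence skew_mat_phi_iff)

lemma phi_act: "X \<in> J3 \<Longrightarrow> phi (act A X) = A ** phi X ** transpose A"
  by (simp add: act_def)

text \<open>Agreement on \<open>J3\<close> suffices, since both maps are \<open>undefined\<close>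
  elsewhere.\<close>

lemma act_eqI:
  assumes "\<alpha> \<in> extensional J3" "\<And>X. X \<in> J3 \<Longrightarrow> phi (\<alpha> X) = A ** phi X ** transpose A"
  shows "\<alpha> = act A"
proof (rule extensionalityI[OF assms(1)])
  show "act A \<in> extensional J3" by (simp add: act_def)
  show "\<alpha> X = act A X" if "X \<in> J3" for X
    using assms(2)[OF that] phi_act[OF that] phi_inject by metis
qed

lemma act_mult: "act (A ** B) = compose J3 (act A) (act B)"
  by (rule act_eqI[symmetric])
    (simp_all add: compose_eq phi_act act_mem matrix_transpose_mul matrix_mul_assoc)

lemma act_one: "act (mat 1) = (\<lambda>X\<in>J3. X)"
  by (rule act_eqI[symmetric]) (simp_all add: transpose_mat)

lemma act_Bij:
  assumes "A ** B = mat 1" "B ** A = mat 1"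
  shows "act A \<in> Bij J3"
proof -
  have inv: "act B (act A X) = X" "act A (act B X) = X" if "X \<in> J3" for X
    using fun_cong[OF act_mult[of A B], of X] fun_cong[OF act_mult[of B A], of X] that
    by (simp_all add: assms act_one compose_eq)
  have "bij_betw (act A) J3 J3"
    by (rule bij_betw_byWitness[where f' = "act B"]) (auto simp: inv act_mem)
  then show ?thesis by (simp add: Bij_def act_def)
qed

lemma act_in_E6:
  assumes A: "A \<in> carrier SU_2_4"
  shows "act A \<in> carrier E6_m14_H"
proof -
  from A have M: "cadjoint A ** I2 ** A = I2" and d: "det A = 1"
    by (simp_all add: SU_2_4_def)
  obtain B where B: "A ** B = mat 1" "B ** A = mat 1"
    using d invertible_det_nz[of A] by (auto simp: invertible_def)
  have add: "act A (X + Y) = act A X + act A Y" if "X \<in> J3" "Y \<in> J3" for X Y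
  proof -
    have "phi (act A (X + Y)) = phi (act A X + act A Y)"
      using that by (simp add: phi_act phi_add J3_add matrix_add_ldistrib mat_add_mult_right)
    then show ?thesis by (simp only: phi_inject)
  qed
  have scale: "act A (c *\<^sub>C X) = c *\<^sub>C act A X" if "X \<in> J3" for c X
  proof -
    have "A ** (c *\<^sub>m phi X) ** transpose A = c *\<^sub>m (A ** phi X ** transpose A)"
      unfolding vec_eq_iff congruence_nth smul_nth
      by (simp add: congruence_nth sum_distrib_left algebra_simps)
    then have "phi (act A (c *\<^sub>C X)) = phi (c *\<^sub>C act A X)"
      using that by (simp add: phi_act phi_scaleC J3_scaleC)
    then show ?thesis by (simp only: phi_inject)
  qed
  have det: "jdet (act A X) = jdet X" if "X \<in> J3" for X
    using that pf_congruence[of "phi X" A] pf_phi[OF act_mem[OF that, of A]] pf_phi[OF that]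
    by (simp add: phi_act skew_mat_phi_iff d)
  have herm: "herm_sigma (act A X) (act A Y) = herm_sigma X Y" if "X \<in> J3" "Y \<in> J3" for X Y
  proof -
    have "herm_sigma (act A X) (act A Y) = hform (phi (act A X)) (phi (act A Y))"
      using that by (simp add: hform_phi act_mem)
    also have "\<dots> = hform (phi X) (phi Y)"
      using that by (simp only: phi_act hform_congruence M transpose_I2 hform_I2[of "phi X" "phi Y"])
    also have "\<dots> = herm_sigma X Y"
      using that by (simp add: hform_phi)
    finally show ?thesis .
  qed
  show ?thesis
    using act_Bij[OF B] add scale det herm by (simp add: E6_m14_H_def Iso_C_J3_def)
qed

text \<open>Surjectivity of \<open>act\<close>: transported by \<open>phi\<close>,
  \<open>\<alpha>\<close> becomes a linear Pfaffian preserver, hence a congruence by some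
  \<open>A\<close> of determinant 1, and the Hermitian form puts \<open>A\<close> into
  \<open>SU(2,4)\<close>.\<close>

lemma E6_eq_act:
  assumes "\<alpha> \<in> carrier E6_m14_H"
  obtains A where "A \<in> carrier SU_2_4" "\<alpha> = act A"
proof -
  from assms have bij: "\<alpha> \<in> Bij J3"
    and add: "\<And>X Y. X \<in> J3 \<Longrightarrow> Y \<in> J3 \<Longrightarrow> \<alpha> (X + Y) = \<alpha> X + \<alpha> Y"
    and scale: "\<And>c X. X \<in> J3 \<Longrightarrow> \<alpha> (c *\<^sub>C X) = c *\<^sub>C \<alpha> X"
    and det: "\<And>X. X \<in> J3 \<Longrightarrow> jdet (\<alpha> X) = jdet X"
    and herm: "\<And>X Y. X \<in> J3 \<Longrightarrow> Y \<in> J3 \<Longrightarrow> herm_sigma (\<alpha> X) (\<alpha> Y) = herm_sigma X Y"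
    by (simp_all add: E6_m14_H_def Iso_C_J3_def)
  have bb: "bij_betw \<alpha> J3 J3" and ext: "\<alpha> \<in> extensional J3"
    using bij by (simp_all add: Bij_def)
  have mem: "\<alpha> X \<in> J3" if "X \<in> J3" for X
    using bb that by (rule bij_betw_apply)
  define \<beta> where "\<beta> K = phi (\<alpha> (psi K))" for K
  have psi_add: "psi (K + L) = psi K + psi L" for K L
    by (rule phi_inject[THEN iffD1]) (simp add: phi_add)
  have psi_smul: "psi (c *\<^sub>m K) = c *\<^sub>C psi K" for c K
    by (rule phi_inject[THEN iffD1]) (simp add: phi_scaleC)
  obtain A where A: "det A = 1" "\<And>K. skew_mat K \<Longrightarrow> \<beta> K = A ** K ** transpose A"
  proof (rule pf_preserver_congruence[of \<beta>])
    show "skew_mat (\<beta> K)" if "skew_mat K" for K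
      using that by (simp add: \<beta>_def skew_mat_phi_iff mem skew_mat_psi)
    show "\<beta> (K + L) = \<beta> K + \<beta> L" if "skew_mat K" "skew_mat L" for K L
      using that by (simp add: \<beta>_def psi_add add phi_add skew_mat_psi)
    show "\<beta> (c *\<^sub>m K) = c *\<^sub>m \<beta> K" if "skew_mat K" for c K
      using that by (simp add: \<beta>_def psi_smul scale phi_scaleC skew_mat_psi)
    show "K = 0" if "skew_mat K" "\<beta> K = 0" for K
    proof -
      have "0 *\<^sub>C (0::quat_mat) = 0"
        by (rule phi_inject[THEN iffD1]) (simp add: phi_scaleC phi_0)
      then have "\<alpha> 0 = 0 *\<^sub>C \<alpha> 0" using scale[OF J3_zero, of 0] by simp
      also have "\<dots> = 0"
        by (rule phi_inject[THEN iffD1]) (simp add: phi_scaleC phi_0)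
      finally have "\<alpha> 0 = 0" .
      moreover have "\<alpha> (psi K) = 0"
        using that(2) unfolding \<beta>_def phi_0[symmetric] phi_inject .
      ultimately have "psi K = 0"
        using bb J3_zero skew_mat_psi[OF that(1)] unfolding bij_betw_def inj_on_def by metis
      then show "K = 0" using phi_psi[of K] phi_0 by simp
    qed
    show "\<exists>K. skew_mat K \<and> \<beta> K = L" if L: "skew_mat L" for L
    proof -
      obtain X where "X \<in> J3" "\<alpha> X = psi L"
        using bb skew_mat_psi[OF L] unfolding bij_betw_def by (metis imageE)
      then show ?thesis
        by (intro exI[of _ "phi X"]) (simp add: \<beta>_def skew_mat_phi_iff)
    qed
    show "pf (\<beta> K) = pf K" if "skew_mat K" for K
      using that pf_phi[OF skew_mat_psi[OF that]]
      by (simp add: \<beta>_def pf_phi mem skew_mat_psi det)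
  qed blast
  have alpha: "phi (\<alpha> X) = A ** phi X ** transpose A" if "X \<in> J3" for X
    using A(2)[of "phi X"] that by (simp add: \<beta>_def skew_mat_phi_iff)
  have "hform (A ** K ** transpose A) (A ** L ** transpose A) = hform K L"
    if "skew_mat K" "skew_mat L" for K L
    using that herm[of "psi K" "psi L"] alpha[of "psi K"] alpha[of "psi L"]
      hform_phi[of "psi K" "psi L"] hform_phi[of "\<alpha> (psi K)" "\<alpha> (psi L)"]
    by (simp add: skew_mat_psi mem)
  then have "cadjoint A ** I2 ** A = I2"
    using hform_preserved_imp signature_not_reversed by blast
  then have "A \<in> carrier SU_2_4" using A(1) by (simp add: SU_2_4_def)
  moreover have "\<alpha> = act A" by (rule act_eqI[OF ext alpha])
  ultimately show ?thesis by (rule that)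
qed

theorem theorem5p4p3:
  shows "E6_m14_H \<cong> SU_2_4 Mod {mat 1, - mat 1}"
proof -
  interpret G: group SU_2_4 by (rule group_SU_2_4)
  interpret H: group E6_m14_H by (rule group_E6_m14_H)
  have hom: "act \<in> hom SU_2_4 E6_m14_H"
  proof (rule homI)
    fix A B assume AB: "A \<in> carrier SU_2_4" "B \<in> carrier SU_2_4"
    then have "act A \<in> Bij J3" "act B \<in> Bij J3"
      using act_in_E6 by (auto simp: E6_m14_H_def Iso_C_J3_def)
    then show "act (A \<otimes>\<^bsub>SU_2_4\<^esub> B) = act A \<otimes>\<^bsub>E6_m14_H\<^esub> act B"
      by (simp add: SU_2_4_def E6_m14_H_def BijGroup_def act_mult)
  qed (rule act_in_E6)
  interpret group_hom SU_2_4 E6_m14_H act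
    by unfold_locales (rule hom)
  have "act ` carrier SU_2_4 = carrier E6_m14_H"
    using act_in_E6 E6_eq_act by (metis (no_types, lifting) image_eqI image_subsetI subsetI subset_antisym)
  moreover have "kernel SU_2_4 E6_m14_H act = {mat 1, - mat 1}"
  proof -
    have one: "\<one>\<^bsub>E6_m14_H\<^esub> = (\<lambda>X\<in>J3. X)" by (simp add: E6_m14_H_def BijGroup_def)
    \<comment> \<open>A trivial action on \<open>J3\<close> is, through \<open>psi\<close>, a
      trivial congruence on all skew matrices.\<close>
    have "A = mat 1 \<or> A = - mat 1" if "act A = (\<lambda>X\<in>J3. X)" for A
    proof (rule trivial_congruence[OF card_6_ge_5])
      show "A ** K ** transpose A = K" if "skew_mat K" for K
        using that phi_act[of "psi K" A] \<open>act A = (\<lambda>X\<in>J3. X)\<close> by (simp add: skew_mat_psi)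
    qed
    moreover have "act (- mat 1) = (\<lambda>X\<in>J3. X)"
    proof (rule act_eqI[symmetric])
      have "transpose (- mat 1) = (- mat 1 :: complex^6^6)"
        by (auto simp: transpose_def mat_def vec_eq_iff)
      then show "phi ((\<lambda>X\<in>J3. X) X) = - mat 1 ** phi X ** transpose (- mat 1)" if "X \<in> J3" for X
        using that by (simp add: mat_neg_mult)
    qed simp
    moreover have "{mat 1, - mat 1} \<subseteq> carrier SU_2_4"
      by (rule subgroup.subset[OF normal_imp_subgroup[OF normal_Z2]])
    ultimately show ?thesis
      unfolding kernel_def one using act_one by blast
  qed
  \<comment> \<open>The first isomorphism theorem maps out of the quotient, so the isomorphism is
    inverted afterwards.\<close>
  ultimately have "SU_2_4 Mod {mat 1, - mat 1} \<cong> E6_m14_H"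
    using FactGroup_iso by simp
  then show ?thesis
    by (rule group.iso_sym[OF normal.factorgroup_is_group[OF normal_Z2]])
qed

end
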